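(* Let $\{X_i\}_{i\geq 1}$ be a time-homogeneous Markov chain on $(\mathcal{X},\mathcal{B})$ with invariant probability measure $\pi$ and right spectral gap $1-\lambda_r>0$. Then for any $n\ge1$, any bounded measurable function $f:\mathcal{X}\to[a,b]$ and any $t\in\mathbb{R}$, $$\mathbb{E}_\pi\left[e^{t\left(\sum_{i=1}^n f(X_i)-n\pi(f)\right)}\right]\leq\exp\left(\frac{t^2}{2}\cdot\alpha(\lambda_r\vee 0)\cdot\frac{n(b-a)^2}{4}\right).$$ It follows that for any $\epsilon>0$, $$\mathbb{P}_\pi\left(\left|\sum_{i=1}^n f(X_i)-n\pi(f)\right|>\epsilon\right)\leq 2\exp\left(-\frac{\alpha(\lambda_r\vee0)^{-1}\epsilon^2}{2n(b-a)^2/4}\right).$$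
   Context: The state space $(\mathcal{X},\mathcal{B})$ is a standard Borel space. A transition kernel $P$ is invariant with a probability measure $\pi$ if $\pi(B)=\int P(x,B)\,\pi(dx)$ for all $B\in\mathcal{B}$. $\mathcal{L}_2(\pi)$ is the real Hilbert space of $\pi$-square-integrable measurable real functions on $\mathcal{X}$, with inner product $\langle h_1,h_2\rangle_\pi=\int h_1h_2\,d\pi$ and norm $\|h\|_\pi$; $\pi(h):=\int h\,d\pi$. The kernel acts on $\mathcal{L}_2(\pi)$ as the Markov operator $Ph(x)=\int h(y)P(x,dy)$, with adjoint $P^*$. Let $R=(P+P^* )/2$ (additive reversiblization). The chain admits right spectral gap $1-\lambda_r$ if $\lambda_r:=\sup\{\langle Rh,h\rangle_\pi:\|h\|_\pi=1,\ \pi(h)=0\}<1$ (equivalently, $\lambda_r$ is the supremum of the spectrum of $R$ acting on $\{h\in\mathcal{L}_2(\pi):\pi(h)=0\}$). The chain is not assumed reversible. $\mathbb{E}_\pi$, $\mathbb{P}_\pi$ denote expectation and probability when $X_1\sim\pi$. $\alpha(\lambda)=\frac{1+\lambda}{1-\lambda}$ and $\xi_1\vee\xi_2=\max\{\xi_1,\xi_2\}$. *)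

theory Defs
  imports "HOL-Probability.Probability"
begin

text \<open>A measurable space is standard Borel if its sigma-algebra is generated by the open sets of
  some Polish topology on the underlying set.\<close>

definition standard_borel :: "'a measure \<Rightarrow> bool" where
  "standard_borel M \<longleftrightarrow>
     (\<exists>T. topspace T = space M \<and> completely_metrizable_space T \<and> separable_space T \<and>
          sets M = sigma_sets (space M) {U. openin T U})"

definition transition_kernel :: "'a measure \<Rightarrow> ('a \<Rightarrow> 'a measure) \<Rightarrow> bool" where
  "transition_kernel M P \<longleftrightarrow> P \<in> measurable M (prob_algebra M)"

definition invariant_prob :: "'a measure \<Rightarrow> ('a \<Rightarrow> 'a measure) \<Rightarrow> 'a measure \<Rightarrow> bool" where
  "invariant_prob M P \<pi> \<longleftrightarrow>
     prob_space \<pi> \<and> sets \<pi> = sets M \<and>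
     (\<forall>B\<in>sets M. emeasure \<pi> B = (\<integral>\<^sup>+ x. emeasure (P x) B \<partial>\<pi>))"

text \<open>Elements of the Hilbert space are represented by functions rather than by classes modulo
  almost everywhere equality; every quantity below depends only on the class.\<close>

definition l2_space :: "'a measure \<Rightarrow> ('a \<Rightarrow> real) set" where
  "l2_space \<pi> = {h \<in> borel_measurable \<pi>. integrable \<pi> (\<lambda>x. (h x)\<^sup>2)}"

definition l2_inner :: "'a measure \<Rightarrow> ('a \<Rightarrow> real) \<Rightarrow> ('a \<Rightarrow> real) \<Rightarrow> real" where
  "l2_inner \<pi> g h = (\<integral>x. g x * h x \<partial>\<pi>)"

definition l2_norm :: "'a measure \<Rightarrow> ('a \<Rightarrow> real) \<Rightarrow> real" where
  "l2_norm \<pi> h = sqrt (l2_inner \<pi> h h)"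

definition markov_op :: "('a \<Rightarrow> 'a measure) \<Rightarrow> ('a \<Rightarrow> real) \<Rightarrow> 'a \<Rightarrow> real" where
  "markov_op P h = (\<lambda>x. \<integral>y. h y \<partial>(P x))"

text \<open>For a bounded operator and a square-integrable argument, the function chosen here exists by
  the Riesz representation theorem and is unique up to almost everywhere equality.\<close>

definition l2_adjoint ::
    "'a measure \<Rightarrow> (('a \<Rightarrow> real) \<Rightarrow> ('a \<Rightarrow> real)) \<Rightarrow> ('a \<Rightarrow> real) \<Rightarrow> ('a \<Rightarrow> real)" where
  "l2_adjoint \<pi> T h =
     (SOME k. k \<in> l2_space \<pi> \<and> (\<forall>g\<in>l2_space \<pi>. l2_inner \<pi> (T g) h = l2_inner \<pi> g k))"

definition additive_reversiblization ::
    "'a measure \<Rightarrow> ('a \<Rightarrow> 'a measure) \<Rightarrow> ('a \<Rightarrow> real) \<Rightarrow> 'a \<Rightarrow> real" where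
  "additive_reversiblization \<pi> P h =
     (\<lambda>x. (markov_op P h x + l2_adjoint \<pi> (markov_op P) h x) / 2)"

text \<open>The supremum is taken in the extended reals: if no mean-zero function has norm one (all
  square-integrable functions are almost everywhere constant), it is minus infinity.\<close>

definition lambda_r :: "'a measure \<Rightarrow> ('a \<Rightarrow> 'a measure) \<Rightarrow> ereal" where
  "lambda_r \<pi> P =
     Sup {ereal (l2_inner \<pi> (additive_reversiblization \<pi> P h) h) | h.
            h \<in> l2_space \<pi> \<and> l2_norm \<pi> h = 1 \<and> (\<integral>x. h x \<partial>\<pi>) = 0}"

definition has_right_spectral_gap :: "'a measure \<Rightarrow> ('a \<Rightarrow> 'a measure) \<Rightarrow> bool" where
  "has_right_spectral_gap \<pi> P \<longleftrightarrow> lambda_r \<pi> P < 1"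

definition alpha :: "real \<Rightarrow> real" where
  "alpha l = (1 + l) / (1 - l)"

text \<open>The sigma-algebra generated by \<open>X 1, \<dots>, X i\<close>.\<close>

definition past :: "'w measure \<Rightarrow> 'a measure \<Rightarrow> (nat \<Rightarrow> 'w \<Rightarrow> 'a) \<Rightarrow> nat \<Rightarrow> 'w measure" where
  "past \<Omega> M X i =
     sigma (space \<Omega>) {X j -` A \<inter> space \<Omega> | j A. 1 \<le> j \<and> j \<le> i \<and> A \<in> sets M}"

text \<open>Chains are indexed from 1; \<open>X 0\<close> is irrelevant.\<close>

definition markov_chain ::
    "'w measure \<Rightarrow> 'a measure \<Rightarrow> ('a \<Rightarrow> 'a measure) \<Rightarrow> (nat \<Rightarrow> 'w \<Rightarrow> 'a) \<Rightarrow> bool" where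
  "markov_chain \<Omega> M P X \<longleftrightarrow>
     prob_space \<Omega> \<and>
     (\<forall>i\<ge>1. X i \<in> measurable \<Omega> M) \<and>
     (\<forall>i\<ge>1. \<forall>B\<in>sets M. AE \<omega> in \<Omega>.
        real_cond_exp \<Omega> (past \<Omega> M X i) (indicator (X (Suc i) -` B \<inter> space \<Omega>)) \<omega>
          = measure (P (X i \<omega>)) B)"

end

theory Submission
  imports Defs "HOL-Real_Asymp.Real_Asymp"
begin

text \<open>With \<open>w = exp (t (f - \<pi> f))\<close>, the moment generating function is
  \<open>\<langle>T\<^sup>n\<^sup>-\<^sup>1 w\<^sup>1\<^sup>/\<^sup>2, w\<^sup>1\<^sup>/\<^sup>2\<rangle>\<close> for \<open>T = w\<^sup>1\<^sup>/\<^sup>2 P w\<^sup>1\<^sup>/\<^sup>2\<close>. The chain is not reversible, so the right spectral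
  gap does not control the norm of \<open>T\<close>, but it does control the quadratic form:
  \<open>\<langle>P g, g\<rangle> \<le> l \<parallel>g\<parallel>\<^sup>2 + (1 - l) (\<pi> g)\<^sup>2\<close> with \<open>l = max \<lambda>\<^sub>r 0\<close>. As \<open>T\<close> preserves positivity, this bounds
  its numerical radius, and Berger's power inequality passes the bound to \<open>T\<^sup>n\<^sup>-\<^sup>1\<close> without loss.
  There remains \<open>l \<parallel>g\<parallel>\<^sup>2 + (1 - l) (\<pi> g)\<^sup>2 \<le> \<theta> \<integral>g\<^sup>2 / w d\<pi>\<close> with
  \<open>\<theta> = exp (t\<^sup>2 \<alpha>(l) (b - a)\<^sup>2 / 8)\<close>, which by duality is \<open>\<integral>(1 - l) / (\<theta> / w - l) d\<pi> \<le> 1\<close>. The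
  integrand is convex in \<open>f\<close>, so it suffices to treat two-point distributions, and there the
  inequality has the form \<open>H y + l H (- y) \<ge> 0\<close>, where \<open>H \<ge> 0\<close> is Hoeffding's case \<open>l = 0\<close>.\<close>

subsection \<open>The two-point inequality\<close>

text \<open>The difference vanishes at 1 and has derivative
  \<open>(1 - z)^2 / (z * (1 + z)^2) > 0\<close>. For \<open>x = l\<close> the bound reads
  \<open>- 2 / alpha l\<close>, the form in which it meets the quadratic exponent in
  \<open>gap_less_exp\<close>.\<close>

lemma ln_less_Pade:
  fixes x :: real
  assumes "0 < x" "x < 1"
  shows "ln x < - (2 * (1 - x) / (1 + x))"
proof -
  let ?g = "\<lambda>x::real. ln x + 2 * (1 - x) / (1 + x)"
  have "?g x < ?g 1"
  proof (rule DERIV_pos_imp_increasing_open[OF \<open>x < 1\<close>])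
    fix z :: real assume z: "x < z" "z < 1"
    have "(?g has_real_derivative 1 / z - 4 / (1 + z)\<^sup>2) (at z)"
      using z assms by (auto intro!: derivative_eq_intros simp: field_simps power2_eq_square)
    moreover have "1 / z - 4 / (1 + z)\<^sup>2 = (1 - z)\<^sup>2 / (z * (1 + z)\<^sup>2)"
      using z assms by (simp add: divide_simps) (simp add: algebra_simps power2_eq_square)
    moreover have "(1 - z)\<^sup>2 / (z * (1 + z)\<^sup>2) > 0"
      using z assms by (intro divide_pos_pos mult_pos_pos) auto
    ultimately show "\<exists>D. (?g has_real_derivative D) (at z) \<and> D > 0" by auto
  next
    show "continuous_on {x..1} ?g"
      using assms by (intro continuous_intros) auto
  qed
  then show ?thesis by simp
qed

text \<open>The difference of the two sides tends to 0 at 0, and its derivative is the square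
  \<open>(z * cosh z - sinh z)^2\<close> over \<open>z * (sinh z)^2\<close>.\<close>

lemma ln_sinh_quotient_le:
  fixes d :: real
  assumes "d > 0"
  shows "ln (sinh d / d) \<le> 1 + d\<^sup>2 / 2 - d * cosh d / sinh d"
proof -
  let ?g = "\<lambda>d::real. 1 + d\<^sup>2 / 2 - d * cosh d / sinh d - ln (sinh d / d)"
  \<comment> \<open>At 0 the quotients only have default values, so the comparison starts from the
    right-hand limit instead of a value.\<close>
  have lim: "(?g \<longlongrightarrow> 0) (at_right 0)"
    unfolding sinh_field_def cosh_field_def by real_asymp
  have "?g x \<le> ?g d" if x: "0 < x" "x \<le> d" for x
  proof (rule DERIV_nonneg_imp_nondecreasing[OF \<open>x \<le> d\<close>])
    fix z assume z: "x \<le> z" "z \<le> d"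
    have s: "sinh z > 0" using z x by simp
    have "(?g has_real_derivative z - ((cosh z + z * sinh z) * sinh z - z * cosh z * cosh z) / (sinh z)\<^sup>2
        - (cosh z * z - sinh z) / z\<^sup>2 / (sinh z / z)) (at z)"
      using z x s by (auto intro!: derivative_eq_intros simp: power2_eq_square mult.commute)
    moreover have "z - ((cosh z + z * sinh z) * sinh z - z * cosh z * cosh z) / (sinh z)\<^sup>2
        - (cosh z * z - sinh z) / z\<^sup>2 / (sinh z / z) = (z * cosh z - sinh z)\<^sup>2 / (z * (sinh z)\<^sup>2)"
      using z x s by (simp add: divide_simps) (simp add: algebra_simps power2_eq_square)
    moreover have "(z * cosh z - sinh z)\<^sup>2 / (z * (sinh z)\<^sup>2) \<ge> 0"
      using z x by simp
    ultimately show "\<exists>y. (?g has_real_derivative y) (at z) \<and> y \<ge> 0" by auto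
  qed
  then have "eventually (\<lambda>x. ?g x \<le> ?g d) (at_right 0)"
    using assms by (auto simp: eventually_at_right intro!: exI[of _ d])
  then have "0 \<le> ?g d"
    using lim by (intro tendsto_upperbound[OF lim]) auto
  then show ?thesis by simp
qed

text \<open>The slope \<open>k = sinh d / d\<close> is that of the chord of \<open>exp\<close> over
  \<open>{-d..d}\<close>. The tangent with this slope touches \<open>exp\<close> at
  \<open>ln k\<close>, and \<open>ln_sinh_quotient_le\<close> bounds its intercept
  \<open>k * (1 - ln k)\<close> from below. At \<open>y = d^2 / 2 - r * d\<close> the line has the
  value \<open>cosh d - r * sinh d\<close>: Hoeffding's lemma for two points.\<close>

lemma exp_ge_sinh_tangent:
  fixes d y :: real
  assumes "d > 0"
  shows "sinh d / d * y + cosh d - d / 2 * sinh d \<le> exp y"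
proof -
  define k where "k = sinh d / d"
  have k: "k > 0" using assms by (simp add: k_def)
  have "k * (1 + (y - ln k)) \<le> k * exp (y - ln k)"
    using k exp_ge_add_one_self by (intro mult_left_mono) auto
  also have "\<dots> = exp y" using k by (simp add: exp_diff)
  finally have 1: "k * (1 + (y - ln k)) \<le> exp y" .
  have "k * ln k \<le> k * (1 + d\<^sup>2 / 2 - d * cosh d / sinh d)"
    using ln_sinh_quotient_le[OF assms] k by (intro mult_left_mono) (auto simp: k_def)
  also have "\<dots> = k + d / 2 * sinh d - cosh d"
    using assms by (simp add: k_def field_simps power2_eq_square)
  finally show ?thesis
    using 1 by (simp add: algebra_simps flip: k_def)
qed

text \<open>The two-state matrix with second eigenvalue \<open>l\<close> and stationary weights
  \<open>(1 + r) / 2\<close>, \<open>(1 - r) / 2\<close>, tilted by \<open>exp (- d)\<close>,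
  \<open>exp d\<close>, has the left side as trace and \<open>l\<close> as determinant. The claim is
  that its characteristic polynomial is nonnegative at \<open>exp y\<close>. The tangent bound is
  used at \<open>y\<close> and, with weight \<open>l\<close>, at \<open>- y\<close>.\<close>

lemma two_state_trace_le:
  fixes d l r :: real
  assumes d: "d > 0" and l: "0 \<le> l" "l < 1"
  defines "y \<equiv> alpha l * d\<^sup>2 / 2 - r * d"
  shows "(1 + l) * cosh d - (1 - l) * r * sinh d \<le> exp y + l * exp (- y)"
proof -
  let ?k = "sinh d / d" and ?c = "cosh d - d / 2 * sinh d"
  have "(?k * y + ?c) + l * (?k * (- y) + ?c) \<le> exp y + l * exp (- y)"
    using exp_ge_sinh_tangent[OF d, of y] exp_ge_sinh_tangent[OF d, of "- y"] l
    by (intro add_mono mult_left_mono) (auto simp: algebra_simps)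
  also have "(?k * y + ?c) + l * (?k * (- y) + ?c) = (1 - l) * ?k * y + (1 + l) * ?c"
    by algebra
  \<comment> \<open>This fixes the constant \<open>alpha l\<close>: as
    \<open>(1 - l) * alpha l = 1 + l\<close>, the quadratic part of \<open>y\<close> cancels exactly
    the \<open>d / 2 * sinh d\<close> in \<open>(1 + l) * ?c\<close>.\<close>
  also have "(1 - l) * ?k * y = (1 + l) * (d / 2) * sinh d - (1 - l) * r * sinh d"
    using d l by (simp add: y_def alpha_def field_simps power2_eq_square)
  finally show ?thesis by (simp add: algebra_simps)
qed

text \<open>Keeps the denominators of the resolvent positive up to \<open>B\<close>. With
  \<open>B \<le> B - A = 2 * d\<close>, completing the square bounds the exponent below by
  \<open>- 2 / alpha l\<close>, which exceeds \<open>ln l\<close>. The case \<open>l = 0\<close> is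
  apart because of \<open>ln l\<close>.\<close>

lemma gap_less_exp:
  fixes A B l :: real
  assumes "A \<le> 0" "0 \<le> B" "A < B" and l: "0 \<le> l" "l < 1"
  shows "l < exp (alpha l * (B - A)\<^sup>2 / 8) * exp (- B)"
proof (cases "l = 0")
  case False
  with l have l: "0 < l" "l < 1" by auto
  define d where "d = (B - A) / 2"
  have al: "alpha l > 0" using l by (simp add: alpha_def)
  have "0 \<le> (alpha l * d - 2)\<^sup>2 / (2 * alpha l)" using al by simp
  also have "\<dots> = alpha l * d\<^sup>2 / 2 - 2 * d + 2 / alpha l"
    using al by (simp add: field_simps power2_eq_square)
  finally have "- (2 / alpha l) \<le> alpha l * d\<^sup>2 / 2 - 2 * d" by simp
  also have "\<dots> \<le> alpha l * (B - A)\<^sup>2 / 8 - B"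
    using assms by (simp add: d_def power_divide)
  also have "- (2 / alpha l) = - (2 * (1 - l) / (1 + l))" by (simp add: alpha_def)
  finally have "ln l < alpha l * (B - A)\<^sup>2 / 8 - B"
    using ln_less_Pade[OF l] by simp
  then have "exp (ln l) < exp (alpha l * (B - A)\<^sup>2 / 8 - B)" by (simp only: exp_less_mono)
  then show ?thesis using l unfolding diff_conv_add_uminus[of _ B] exp_add by simp
qed auto

text \<open>The weights are the masses at \<open>A\<close> and \<open>B\<close> of the mean-zero
  distribution on these two points. In terms of the half-width \<open>d\<close> and the asymmetry
  \<open>r\<close>, the inequality is \<open>two_state_trace_le\<close> multiplied by
  \<open>exp y\<close>.\<close>

lemma two_point_resolvent_le:
  fixes A B l :: real
  assumes AB: "A \<le> 0" "0 \<le> B" "A < B" and l: "0 \<le> l" "l < 1"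
  defines "th \<equiv> exp (alpha l * (B - A)\<^sup>2 / 8)"
  shows "(1 - l) * (B / (B - A) / (th * exp (- A) - l) + (- A) / (B - A) / (th * exp (- B) - l)) \<le> 1"
proof -
  define d where "d = (B - A) / 2"
  define r where "r = (A + B) / (B - A)"
  define y where "y = alpha l * d\<^sup>2 / 2 - r * d"
  define p where "p = (1 + r) / 2"
  have d: "d > 0" using AB by (simp add: d_def)
  have p: "B / (B - A) = p" "(- A) / (B - A) = 1 - p"
    using AB by (simp_all add: p_def r_def field_simps)
  have rd: "r * d = (A + B) / 2" using AB by (simp add: r_def d_def)
  have A: "th * exp (- A) = exp y * exp d" and B: "th * exp (- B) = exp y * exp (- d)"
    unfolding th_def y_def rd by (simp_all add: d_def power_divide field_simps flip: exp_add)
  define u v where "u = exp y * exp d" and "v = exp y * exp (- d)"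
  have v: "l < v" using gap_less_exp[OF AB l] by (simp add: v_def flip: B th_def)
  have "v \<le> u" using d by (simp add: v_def u_def)
  with v have u: "l < u" by simp
  have uv: "u * v = (exp y)\<^sup>2" by (simp add: u_def v_def exp_minus power2_eq_square)
  \<comment> \<open>Cleared of denominators, the goal is that this left side is at most
    \<open>u * v + l\<close>.\<close>
  have "l * (u + v) + (1 - l) * (p * v + (1 - p) * u) = exp y * ((1 + l) * cosh d - (1 - l) * r * sinh d)"
    by (simp add: u_def v_def p_def cosh_def sinh_def field_simps)
  also have "\<dots> \<le> exp y * (exp y + l * exp (- y))"
    using two_state_trace_le[OF d l, of r] by (intro mult_left_mono) (auto simp: y_def)
  also have "\<dots> = u * v + l" by (simp add: uv algebra_simps power2_eq_square exp_minus)
  finally have "(1 - l) * (p * (v - l) + (1 - p) * (u - l)) \<le> (u - l) * (v - l)"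
    by (simp add: algebra_simps)
  then have "(1 - l) * (p / (u - l) + (1 - p) / (v - l)) \<le> 1"
    using u v by (simp add: divide_simps)
  then show ?thesis unfolding p A B u_def v_def .
qed

section \<open>From two points to bounded functions of mean zero\<close>

text \<open>With \<open>u = c * exp (- s)\<close> the derivative is \<open>u / (u - l)^2\<close>,
  which decreases in \<open>u > l\<close>, while \<open>u\<close> decreases in \<open>s\<close>.
  Cross-multiplied, the comparison is \<open>(u - v) * (u * v - l * l) \<ge> 0\<close>.\<close>

lemma convex_on_resolvent:
  fixes A B l c :: real
  assumes l: "0 \<le> l" and c: "l < c * exp (- B)"
  shows "convex_on {A..B} (\<lambda>s. 1 / (c * exp (- s) - l))"
proof (rule convex_on_realI[where f' = "\<lambda>s. c * exp (- s) / (c * exp (- s) - l)\<^sup>2"])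
  have cp: "c > 0" using l c by (smt (verit) exp_gt_zero mult_le_0_iff)
  have pos: "l < c * exp (- s)" if "s \<le> B" for s
    using c cp that by (smt (verit) exp_le_cancel_iff mult_left_mono)
  show "((\<lambda>s. 1 / (c * exp (- s) - l)) has_real_derivative
      c * exp (- s) / (c * exp (- s) - l)\<^sup>2) (at s)" if "s \<in> {A..B}" for s
    using pos[of s] that by (auto intro!: derivative_eq_intros simp: power2_eq_square)
  fix x z assume xz: "x \<in> {A..B}" "z \<in> {A..B}" "x \<le> z"
  define u v where "u = c * exp (- x)" and "v = c * exp (- z)"
  have uv: "l < v" "v \<le> u" using pos[of z] xz cp by (auto simp: u_def v_def)
  have "l * l \<le> u * v" using uv l by (intro mult_mono) auto
  then have "0 \<le> (u - v) * (u * v - l * l)" using uv by simp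
  then have "u * (v - l)\<^sup>2 \<le> v * (u - l)\<^sup>2"
    by (simp add: algebra_simps power2_eq_square)
  then show "c * exp (- x) / (c * exp (- x) - l)\<^sup>2 \<le> c * exp (- z) / (c * exp (- z) - l)\<^sup>2"
    unfolding u_def[symmetric] v_def[symmetric] using uv
    by (simp add: pos_divide_le_eq pos_le_divide_eq)
qed auto

text \<open>Hoeffding's convexity argument: the resolvent lies below its chord over
  \<open>{A..B}\<close>, and since \<open>F\<close> has mean zero the chord integrates to the value
  for the two-point distribution on the endpoints.\<close>

lemma (in prob_space) expectation_resolvent_le:
  fixes A B l :: real
  assumes AB: "A < B" and l: "0 \<le> l" "l < 1"
    and F[measurable]: "F \<in> borel_measurable M"
    and FAB: "\<forall>x\<in>space M. F x \<in> {A..B}" and F0: "expectation F = 0"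
  defines "th \<equiv> exp (alpha l * (B - A)\<^sup>2 / 8)"
  shows "integrable M (\<lambda>x. 1 / (th * exp (- F x) - l))"
    and "(1 - l) * expectation (\<lambda>x. 1 / (th * exp (- F x) - l)) \<le> 1"
    and "\<And>x. x \<in> space M \<Longrightarrow> l < th * exp (- F x)"
proof -
  have intF: "integrable M F"
    proof (rule integrable_const_bound[where B = "\<bar>A\<bar> + \<bar>B\<bar>"])
    show "AE x in M. norm (F x) \<le> \<bar>A\<bar> + \<bar>B\<bar>"
      using FAB by (intro AE_I2) fastforce
  qed measurable
  have "A \<le> expectation F" using FAB by (intro integral_ge_const intF AE_I2) auto
  then have A: "A \<le> 0" using F0 by simp
  have "expectation F \<le> B" using FAB by (intro integral_le_const intF AE_I2) auto
  then have B: "0 \<le> B" using F0 by simp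
  have c: "l < th * exp (- B)" using gap_less_exp[OF A B AB l] by (simp add: th_def)
  let ?\<phi> = "\<lambda>s. 1 / (th * exp (- s) - l)"
  show pos: "l < th * exp (- F x)" if "x \<in> space M" for x
  proof -
    have "th * exp (- B) \<le> th * exp (- F x)"
      using FAB that by (intro mult_left_mono) (auto simp: th_def)
    with c show ?thesis by simp
  qed
  show int: "integrable M (\<lambda>x. ?\<phi> (F x))"
  proof (rule integrable_const_bound[where B = "?\<phi> B"])
    show "AE x in M. norm (?\<phi> (F x)) \<le> ?\<phi> B"
    proof (rule AE_I2)
      fix x assume x: "x \<in> space M"
      have "th * exp (- B) \<le> th * exp (- F x)"
        using FAB x by (intro mult_left_mono) (auto simp: th_def)
      then show "norm (?\<phi> (F x)) \<le> ?\<phi> B" using c pos[OF x] by (simp add: frac_le)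
    qed
  qed measurable
  have "?\<phi> (F x) \<le> (?\<phi> B - ?\<phi> A) / (B - A) * (F x - A) + ?\<phi> A" if "x \<in> space M" for x
    using convex_onD_Icc'[OF convex_on_resolvent[OF l(1) c], of "F x" A] FAB that by simp
  then have "expectation (\<lambda>x. ?\<phi> (F x)) \<le> expectation (\<lambda>x. (?\<phi> B - ?\<phi> A) / (B - A) * (F x - A) + ?\<phi> A)"
    using int intF by (intro integral_mono) auto
  also have "\<dots> = (?\<phi> B - ?\<phi> A) / (B - A) * (- A) + ?\<phi> A"
    using intF F0 by (simp add: prob_space)
  also have "\<dots> = B / (B - A) * ?\<phi> A + (- A) / (B - A) * ?\<phi> B"
  proof -
    have "(q - p) / (B - A) * (- A) + p = B / (B - A) * p + (- A) / (B - A) * q" for p q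
      using AB by (simp add: divide_simps) (simp add: algebra_simps)
    then show ?thesis .
  qed
  finally have "(1 - l) * expectation (\<lambda>x. ?\<phi> (F x)) \<le> (1 - l) * (B / (B - A) * ?\<phi> A + (- A) / (B - A) * ?\<phi> B)"
    using l by (intro mult_left_mono) auto
  also have "\<dots> \<le> 1"
    using two_point_resolvent_le[OF A B AB l] by (simp add: th_def)
  finally show "(1 - l) * expectation (\<lambda>x. ?\<phi> (F x)) \<le> 1" .
qed

text \<open>With \<open>W = th * exp (- F) - l > 0\<close> the claim is
  \<open>(1 - l) * (expectation g)^2 \<le> expectation (W * g^2)\<close>; Cauchy-Schwarz reduces it
  to \<open>(1 - l) * expectation (1 / W) \<le> 1\<close>.\<close>

lemma (in prob_space) gap_form_le:
  fixes A B l :: real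
  assumes AB: "A < B" and l: "0 \<le> l" "l < 1"
    and F[measurable]: "F \<in> borel_measurable M"
    and FAB: "\<forall>x\<in>space M. F x \<in> {A..B}" and F0: "expectation F = 0"
    and g: "integrable M g" "integrable M (\<lambda>x. (g x)\<^sup>2)"
  defines "th \<equiv> exp (alpha l * (B - A)\<^sup>2 / 8)"
  shows "l * expectation (\<lambda>x. (g x)\<^sup>2) + (1 - l) * (expectation g)\<^sup>2
    \<le> th * expectation (\<lambda>x. (g x)\<^sup>2 / exp (F x))"
proof -
  note R = expectation_resolvent_le[OF AB l F FAB F0, folded th_def]
  define c where "c = expectation g"
  define W where "W = (\<lambda>x. th * exp (- F x) - l)"
  have W: "W x > 0" if "x \<in> space M" for x using R(3)[OF that] by (simp add: W_def)
  have gF: "integrable M (\<lambda>x. (g x)\<^sup>2 / exp (F x))"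
  proof (rule Bochner_Integration.integrable_bound)
    show "integrable M (\<lambda>x. exp (- A) * (g x)\<^sup>2)" using g by simp
    show "AE x in M. norm ((g x)\<^sup>2 / exp (F x)) \<le> norm (exp (- A) * (g x)\<^sup>2)"
    proof (rule AE_I2)
      fix x assume "x \<in> space M"
      then have "(g x)\<^sup>2 * exp (- F x) \<le> (g x)\<^sup>2 * exp (- A)" using FAB by (intro mult_left_mono) auto
      then show "norm ((g x)\<^sup>2 / exp (F x)) \<le> norm (exp (- A) * (g x)\<^sup>2)"
        by (simp add: exp_minus field_simps)
    qed
  qed (use g in measurable)
  have RW: "integrable M (\<lambda>x. 1 / W x)" using R(1) by (simp add: W_def)
  \<comment> \<open>AM-GM \<open>2 (1 - l) c g \<le> W g\<^sup>2 + ((1 - l) c)\<^sup>2 / W\<close>, integrated, is the weighted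
    Cauchy-Schwarz inequality.\<close>
  have "expectation (\<lambda>x. 2 * (1 - l) * c * g x - ((1 - l) * c)\<^sup>2 * (1 / W x))
      \<le> expectation (\<lambda>x. th * ((g x)\<^sup>2 / exp (F x)) - l * (g x)\<^sup>2)"
  proof (rule integral_mono)
    fix x assume x: "x \<in> space M"
    have "0 \<le> (W x * g x - (1 - l) * c)\<^sup>2 / W x" using W[OF x] by simp
    also have "\<dots> = W x * (g x)\<^sup>2 - 2 * (1 - l) * c * g x + ((1 - l) * c)\<^sup>2 * (1 / W x)"
      using W[OF x] by (simp add: field_simps power2_eq_square)
    finally have "2 * (1 - l) * c * g x - ((1 - l) * c)\<^sup>2 * (1 / W x) \<le> W x * (g x)\<^sup>2" by simp
    also have "\<dots> = th * ((g x)\<^sup>2 / exp (F x)) - l * (g x)\<^sup>2"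
      by (simp add: W_def exp_minus field_simps)
    finally show "2 * (1 - l) * c * g x - ((1 - l) * c)\<^sup>2 * (1 / W x)
      \<le> th * ((g x)\<^sup>2 / exp (F x)) - l * (g x)\<^sup>2" .
  qed (intro Bochner_Integration.integrable_diff integrable_mult_right g gF RW)+
  also have "\<dots> = th * expectation (\<lambda>x. (g x)\<^sup>2 / exp (F x)) - l * expectation (\<lambda>x. (g x)\<^sup>2)"
    using g gF by (subst Bochner_Integration.integral_diff)
      (auto intro!: integrable_mult_right simp del: times_divide_eq_right)
  also have "expectation (\<lambda>x. 2 * (1 - l) * c * g x - ((1 - l) * c)\<^sup>2 * (1 / W x))
      = 2 * (1 - l) * c\<^sup>2 - ((1 - l) * c)\<^sup>2 * expectation (\<lambda>x. 1 / W x)"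
    using g RW by (subst Bochner_Integration.integral_diff)
      (auto intro!: integrable_mult_right simp: c_def power2_eq_square simp del: times_divide_eq_right)
  finally have 1: "2 * (1 - l) * c\<^sup>2 - ((1 - l) * c)\<^sup>2 * expectation (\<lambda>x. 1 / W x)
    \<le> th * expectation (\<lambda>x. (g x)\<^sup>2 / exp (F x)) - l * expectation (\<lambda>x. (g x)\<^sup>2)" .
  have "(1 - l) * c\<^sup>2 * ((1 - l) * expectation (\<lambda>x. 1 / W x)) \<le> (1 - l) * c\<^sup>2 * 1"
    using R(2) l by (intro mult_left_mono) (auto simp: W_def)
  then have "((1 - l) * c)\<^sup>2 * expectation (\<lambda>x. 1 / W x) \<le> (1 - l) * c\<^sup>2"
    by (simp add: power2_eq_square algebra_simps)
  with 1 show ?thesis unfolding c_def by (simp add: algebra_simps)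
qed

subsection \<open>Kernels with an invariant probability measure\<close>

text \<open>Fubini for kernels and signed functions: the nonnegative version is applied to the parts
  \<open>p\<close> and \<open>m\<close>, whose integrals are finite. The inner integral is the
  difference of the parts only almost everywhere, since it defaults to 0 where \<open>g\<close> is
  not integrable under \<open>K x\<close>.\<close>

lemma
  fixes g :: "'b \<Rightarrow> real"
  assumes K[measurable]: "K \<in> N \<rightarrow>\<^sub>M subprob_algebra B"
    and g: "integrable (N \<bind> K) g" and N: "space N \<noteq> {}"
  shows AE_integrable_bind: "AE x in N. integrable (K x) g"
    and integrable_integral_bind: "integrable N (\<lambda>x. \<integral>y. g y \<partial>K x)"
    and integral_bind_integrable: "(\<integral>x. \<integral>y. g y \<partial>K x \<partial>N) = (\<integral>y. g y \<partial>(N \<bind> K))"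
proof -
  define p where "p = (\<lambda>x. \<integral>\<^sup>+y. ennreal (g y) \<partial>K x)"
  define m where "m = (\<lambda>x. \<integral>\<^sup>+y. ennreal (- g y) \<partial>K x)"
  have setsK: "sets (N \<bind> K) = sets B" by (rule sets_bind_measurable[OF K N])
  have gB[measurable]: "g \<in> borel_measurable B"
    using g by (simp add: measurable_cong_sets[OF setsK refl] integrable_iff_bounded)
  have [measurable]: "p \<in> borel_measurable N" "m \<in> borel_measurable N"
    unfolding p_def m_def by measurable
  have pI: "(\<integral>\<^sup>+x. p x \<partial>N) = (\<integral>\<^sup>+y. ennreal (g y) \<partial>(N \<bind> K))"
    unfolding p_def by (subst nn_integral_bind[OF _ K]) auto
  have mI: "(\<integral>\<^sup>+x. m x \<partial>N) = (\<integral>\<^sup>+y. ennreal (- g y) \<partial>(N \<bind> K))"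
    unfolding m_def by (subst nn_integral_bind[OF _ K]) auto
  have pf: "(\<integral>\<^sup>+x. p x \<partial>N) \<noteq> \<infinity>" and mf: "(\<integral>\<^sup>+x. m x \<partial>N) \<noteq> \<infinity>"
    using g by (auto simp: pI mI real_integrable_def)
  have pA: "AE x in N. p x \<noteq> \<infinity>" and mA: "AE x in N. m x \<noteq> \<infinity>"
    by (intro nn_integral_noteq_infinite pf mf; measurable)+
  have gK: "g \<in> borel_measurable (K x)" if "x \<in> space N" for x
    using gB sets_kernel[OF K that] by (simp add: measurable_cong_sets[OF sets_kernel[OF K that] refl])
  show AEi: "AE x in N. integrable (K x) g"
    using pA mA AE_space by eventually_elim (auto simp: real_integrable_def gK p_def m_def)
  have eq: "AE x in N. (\<integral>y. g y \<partial>K x) = enn2real (p x) - enn2real (m x)"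
    using AEi by eventually_elim (auto simp: real_lebesgue_integral_def p_def m_def)
  have pe: "(\<integral>\<^sup>+x. ennreal (enn2real (p x)) \<partial>N) = (\<integral>\<^sup>+x. p x \<partial>N)"
    using pA by (intro nn_integral_cong_AE) (auto simp: less_top)
  have me: "(\<integral>\<^sup>+x. ennreal (enn2real (m x)) \<partial>N) = (\<integral>\<^sup>+x. m x \<partial>N)"
    using mA by (intro nn_integral_cong_AE) (auto simp: less_top)
  have int: "integrable N (\<lambda>x. enn2real (p x))" "integrable N (\<lambda>x. enn2real (m x))"
    using pf mf pe me by (auto intro!: integrableI_nonneg simp: less_top)
  have [measurable]: "(\<lambda>x. \<integral>y. g y \<partial>K x) \<in> borel_measurable N"
    by (rule measurable_compose[OF K integral_measurable_subprob_algebra[OF gB]])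
  show "integrable N (\<lambda>x. \<integral>y. g y \<partial>K x)"
    using int eq by (subst integrable_cong_AE[OF _ _ eq]) auto
  have "(\<integral>x. \<integral>y. g y \<partial>K x \<partial>N) = (\<integral>x. enn2real (p x) - enn2real (m x) \<partial>N)"
    using eq by (intro integral_cong_AE) auto
  also have "\<dots> = enn2real (\<integral>\<^sup>+x. p x \<partial>N) - enn2real (\<integral>\<^sup>+x. m x \<partial>N)"
    using int by (simp add: integral_eq_nn_integral pe me)
  also have "\<dots> = (\<integral>y. g y \<partial>(N \<bind> K))"
    using g by (simp add: real_lebesgue_integral_def pI mI)
  finally show "(\<integral>x. \<integral>y. g y \<partial>K x \<partial>N) = (\<integral>y. g y \<partial>(N \<bind> K))" .
qed

text \<open>If a Radon-Nikodym density exceeded \<open>C\<close> on a set of positive measure,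
  \<open>N\<close> would exceed \<open>C * M\<close> there. Truncating at \<open>C\<close> therefore
  leaves the measure unchanged and makes the bounds hold at every point.\<close>

lemma (in finite_measure) RN_deriv_bounded:
  fixes C :: real
  assumes sets: "sets N = sets M" and C: "0 \<le> C"
    and le: "\<And>A. A \<in> sets M \<Longrightarrow> emeasure N A \<le> C * emeasure M A"
  obtains k :: "'a \<Rightarrow> real" where "k \<in> borel_measurable M" "\<And>x. 0 \<le> k x" "\<And>x. k x \<le> C"
    "density M k = N"
proof -
  have "absolutely_continuous M N"
    using le by (fastforce simp: absolutely_continuous_def null_sets_def sets)
  from Radon_Nikodym[OF this sets] obtain k :: "'a \<Rightarrow> ennreal"
    where k[measurable]: "k \<in> borel_measurable M" and dk: "density M k = N" by auto
  define A where "A = {x \<in> space M. C < k x}"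
  have A[measurable]: "A \<in> sets M" unfolding A_def by measurable
  have "(\<integral>\<^sup>+x. k x * indicator A x \<partial>M) = emeasure N A"
    by (simp add: emeasure_density flip: dk)
  also have "\<dots> \<le> C * emeasure M A" by (rule le[OF A])
  also have "\<dots> = (\<integral>\<^sup>+x. ennreal C * indicator A x \<partial>M)" by (simp add: nn_integral_cmult)
  finally have nless: "\<not> (\<integral>\<^sup>+x. ennreal C * indicator A x \<partial>M) < (\<integral>\<^sup>+x. k x * indicator A x \<partial>M)"
    by simp
  have fin: "(\<integral>\<^sup>+x. ennreal C * indicator A x \<partial>M) \<noteq> \<infinity>"
    by (simp add: nn_integral_cmult ennreal_mult_eq_top_iff emeasure_eq_measure)
  have "AE x in M. ennreal C * indicator A x \<le> k x * indicator A x"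
    by (auto simp: A_def indicator_def)
  from nn_integral_less[OF _ _ fin this] nless
  have "AE x in M. k x * indicator A x \<le> ennreal C * indicator A x" by fastforce
  then have kC: "AE x in M. k x \<le> C"
    using AE_space
  proof eventually_elim
    case (elim x)
    have "k x \<le> C" if "x \<in> A" using elim(1) that by simp
    moreover have "k x \<le> C" if "x \<notin> A" using elim(2) that by (simp add: A_def not_less)
    ultimately show ?case by blast
  qed
  let ?k = "\<lambda>x. min C (enn2real (k x))"
  have "AE x in M. ennreal (?k x) = k x"
    using kC
  proof eventually_elim
    case (elim x)
    then have "enn2real (k x) \<le> C" "k x < top"
      using C by (auto simp: enn2real_leI intro: le_less_trans)
    then show ?case by simp
  qed
  then have "density M ?k = N"
    unfolding dk[symmetric] by (intro density_cong) auto
  with that[of ?k] C show ?thesis by auto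
qed

text \<open>Measurability sees only the sigma-algebra, so \<open>\<pi>\<close> also serves as the
  state space. Invariance is put as a fixed point of \<open>\<bind>\<close>, the form on which the
  Fubini lemma above acts.\<close>

locale invariant_kernel = prob_space \<pi> for \<pi> :: "'a measure" +
  fixes P :: "'a \<Rightarrow> 'a measure"
  assumes kernel: "P \<in> \<pi> \<rightarrow>\<^sub>M prob_algebra \<pi>"
    and invariant: "\<pi> \<bind> P = \<pi>"
begin

lemma kernel_subprob[measurable]: "P \<in> \<pi> \<rightarrow>\<^sub>M subprob_algebra \<pi>"
  by (rule measurable_prob_algebraD[OF kernel])

lemma
  assumes "x \<in> space \<pi>"
  shows prob_space_kernel: "prob_space (P x)" and sets_kernel_eq: "sets (P x) = sets \<pi>"
    and space_kernel_eq: "space (P x) = space \<pi>"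
    and measurable_kernel_eq: "measurable (P x) = measurable \<pi>"
  using measurable_space[OF kernel assms]
  by (auto simp: space_prob_algebra dest: sets_eq_imp_space_eq intro!: ext measurable_cong_sets)

lemma borel_measurable_markov_op[measurable]:
  "g \<in> borel_measurable \<pi> \<Longrightarrow> markov_op P g \<in> borel_measurable \<pi>"
  unfolding markov_op_def
  by (rule measurable_compose[OF kernel_subprob integral_measurable_subprob_algebra])

lemma
  assumes "integrable \<pi> g"
  shows integrable_markov_op: "integrable \<pi> (markov_op P g)"
    and integral_markov_op: "(\<integral>x. markov_op P g x \<partial>\<pi>) = (\<integral>x. g x \<partial>\<pi>)"
  using integrable_integral_bind[OF kernel_subprob, of g] integral_bind_integrable[OF kernel_subprob, of g]
    assms not_empty by (simp_all add: markov_op_def[abs_def] invariant)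

section \<open>Bounded measurable functions\<close>

text \<open>This class is closed under \<open>markov_op P\<close> and contains every function at
  which the quadratic form is evaluated, so integrability never obstructs. The bound is asked on
  \<open>space \<pi>\<close> only, where \<open>f\<close> is controlled.\<close>

definition bounded_fun :: "('a \<Rightarrow> real) \<Rightarrow> bool" where
  "bounded_fun h \<longleftrightarrow> h \<in> borel_measurable \<pi> \<and> (\<exists>C. \<forall>x\<in>space \<pi>. \<bar>h x\<bar> \<le> C)"

lemma bounded_funI:
  "h \<in> borel_measurable \<pi> \<Longrightarrow> (\<And>x. x \<in> space \<pi> \<Longrightarrow> \<bar>h x\<bar> \<le> C) \<Longrightarrow> bounded_fun h"
  by (auto simp: bounded_fun_def)

lemma bounded_fun_measurable[measurable_dest]: "bounded_fun h \<Longrightarrow> h \<in> borel_measurable \<pi>"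
  by (simp add: bounded_fun_def)

lemma bounded_funE:
  assumes "bounded_fun h"
  obtains C where "0 \<le> C" "\<And>x. x \<in> space \<pi> \<Longrightarrow> \<bar>h x\<bar> \<le> C"
proof -
  obtain C where C: "\<And>x. x \<in> space \<pi> \<Longrightarrow> \<bar>h x\<bar> \<le> C"
    using assms by (auto simp: bounded_fun_def)
  show ?thesis by (rule that[of "\<bar>C\<bar>"]) (use C in force)+
qed

lemma bounded_fun_const: "bounded_fun (\<lambda>_. c)"
  by (rule bounded_funI[where C = "\<bar>c\<bar>"]) auto

lemma bounded_fun_mult:
  assumes "bounded_fun g" "bounded_fun h"
  shows "bounded_fun (\<lambda>x. g x * h x)"
proof -
  obtain C D where C: "0 \<le> C" "\<And>x. x \<in> space \<pi> \<Longrightarrow> \<bar>g x\<bar> \<le> C"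
    and D: "0 \<le> D" "\<And>x. x \<in> space \<pi> \<Longrightarrow> \<bar>h x\<bar> \<le> D"
    using assms by (metis bounded_funE)
  show ?thesis
    by (rule bounded_funI[where C = "C * D"]) (use assms C D in \<open>auto simp: abs_mult intro!: mult_mono\<close>)
qed

lemma bounded_fun_add:
  assumes "bounded_fun g" "bounded_fun h"
  shows "bounded_fun (\<lambda>x. g x + h x)"
proof -
  obtain C D where C: "0 \<le> C" "\<And>x. x \<in> space \<pi> \<Longrightarrow> \<bar>g x\<bar> \<le> C"
    and D: "0 \<le> D" "\<And>x. x \<in> space \<pi> \<Longrightarrow> \<bar>h x\<bar> \<le> D"
    using assms by (metis bounded_funE)
  show ?thesis
    by (rule bounded_funI[where C = "C + D"]) (use assms C D in \<open>auto intro!: abs_triangle_ineq[THEN order_trans] add_mono\<close>)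
qed

lemma bounded_fun_sum: "(\<And>i. i \<in> I \<Longrightarrow> bounded_fun (g i)) \<Longrightarrow> bounded_fun (\<lambda>x. \<Sum>i\<in>I. g i x)"
  by (induction I rule: infinite_finite_induct) (auto intro: bounded_fun_const bounded_fun_add)

lemma bounded_fun_diff: "bounded_fun g \<Longrightarrow> bounded_fun h \<Longrightarrow> bounded_fun (\<lambda>x. g x - h x)"
  using bounded_fun_add[OF _ bounded_fun_mult[OF bounded_fun_const[of "-1"]], of g h] by simp

lemma bounded_fun_divide_const: "bounded_fun g \<Longrightarrow> bounded_fun (\<lambda>x. g x / c)"
  using bounded_fun_mult[OF _ bounded_fun_const[of "inverse c"], of g] by (simp add: divide_inverse)

lemma bounded_fun_power2: "bounded_fun g \<Longrightarrow> bounded_fun (\<lambda>x. (g x)\<^sup>2)"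
  unfolding power2_eq_square by (rule bounded_fun_mult)

lemma bounded_fun_sqrt:
  assumes "bounded_fun g"
  shows "bounded_fun (\<lambda>x. sqrt (g x))"
proof -
  obtain C where C: "0 \<le> C" "\<And>x. x \<in> space \<pi> \<Longrightarrow> \<bar>g x\<bar> \<le> C"
    using assms by (metis bounded_funE)
  show ?thesis
    by (rule bounded_funI[where C = "sqrt C"]) (use assms C in \<open>auto simp: abs_le_iff simp flip: real_sqrt_minus\<close>)
qed

lemma integrable_bounded_fun: "bounded_fun h \<Longrightarrow> integrable \<pi> h"
  by (auto simp: bounded_fun_def intro!: integrable_const_bound AE_I2)

lemma integrable_mult_bounded_fun:
  assumes "integrable \<pi> g" "bounded_fun h"
  shows "integrable \<pi> (\<lambda>x. g x * h x)"
proof -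
  obtain C where C: "0 \<le> C" "\<And>x. x \<in> space \<pi> \<Longrightarrow> \<bar>h x\<bar> \<le> C"
    using assms by (metis bounded_funE)
  have "integrable \<pi> (\<lambda>x. C * \<bar>g x\<bar>)" using assms by simp
  then show ?thesis
    by (rule Bochner_Integration.integrable_bound)
      (use assms C in \<open>auto intro!: AE_I2 mult_left_mono simp: abs_mult mult.commute[of C]\<close>)
qed

lemma bounded_fun_l2_space: "bounded_fun h \<Longrightarrow> h \<in> l2_space \<pi>"
  by (simp add: l2_space_def bounded_fun_power2 integrable_bounded_fun bounded_fun_measurable)

lemma l2_space_integrable: "h \<in> l2_space \<pi> \<Longrightarrow> integrable \<pi> h"
  by (auto simp: l2_space_def intro: square_integrable_imp_integrable)

lemma integrable_kernel_bounded_fun: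
  assumes "bounded_fun h" "x \<in> space \<pi>"
  shows "integrable (P x) h"
proof -
  interpret K: prob_space "P x" by (rule prob_space_kernel[OF assms(2)])
  show ?thesis
    using assms by (auto simp: bounded_fun_def measurable_kernel_eq space_kernel_eq intro!: K.integrable_const_bound AE_I2)
qed

lemma bounded_fun_markov_op:
  assumes "bounded_fun h"
  shows "bounded_fun (markov_op P h)"
proof -
  obtain C where C: "0 \<le> C" "\<And>x. x \<in> space \<pi> \<Longrightarrow> \<bar>h x\<bar> \<le> C"
    using assms by (metis bounded_funE)
  show ?thesis
  proof (rule bounded_funI[where C = C])
    fix x assume x: "x \<in> space \<pi>"
    interpret K: prob_space "P x" by (rule prob_space_kernel[OF x])
    have i: "integrable (P x) h" by (rule integrable_kernel_bounded_fun[OF assms x])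
    have "\<bar>markov_op P h x\<bar> \<le> (\<integral>y. \<bar>h y\<bar> \<partial>P x)"
      unfolding markov_op_def by (rule integral_abs_bound)
    also have "\<dots> \<le> C" using i C x by (intro K.integral_le_const AE_I2) (auto simp: space_kernel_eq)
    finally show "\<bar>markov_op P h x\<bar> \<le> C" .
  qed (use assms in measurable)
qed

lemmas bounded_fun_intros = bounded_fun_const bounded_fun_mult bounded_fun_add bounded_fun_sum
  bounded_fun_diff bounded_fun_divide_const bounded_fun_power2 bounded_fun_sqrt bounded_fun_markov_op

section \<open>The adjoint and the right spectral gap\<close>

text \<open>\<open>k\<close> is the adjoint applied to \<open>h\<close>. The measure with density
  \<open>h\<close>, pushed through \<open>P\<close>, is dominated by \<open>C\<close> times
  \<open>\<pi> \<bind> P = \<pi>\<close>, hence has a density bounded by \<open>C\<close>.\<close>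

lemma adjoint_exists_nonneg:
  assumes h: "bounded_fun h" and h0: "\<And>x. x \<in> space \<pi> \<Longrightarrow> 0 \<le> h x"
  obtains k where "bounded_fun k"
    "\<And>g. integrable \<pi> g \<Longrightarrow> l2_inner \<pi> (markov_op P g) h = l2_inner \<pi> g k"
proof -
  obtain C where C: "0 \<le> C" "\<And>x. x \<in> space \<pi> \<Longrightarrow> \<bar>h x\<bar> \<le> C"
    using h by (metis bounded_funE)
  have hm[measurable]: "h \<in> borel_measurable \<pi>" using h by measurable
  define N where "N = density \<pi> (\<lambda>x. ennreal (h x))"
  have K: "P \<in> N \<rightarrow>\<^sub>M subprob_algebra \<pi>"
    using kernel_subprob by (simp add: N_def measurable_density_eq1)
  have N: "space N \<noteq> {}" using not_empty by (simp add: N_def)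
  have sets: "sets (N \<bind> P) = sets \<pi>" by (rule sets_bind_measurable[OF K N])
  have le: "emeasure (N \<bind> P) A \<le> C * emeasure \<pi> A" if A[measurable]: "A \<in> sets \<pi>" for A
  proof -
    have [measurable]: "(\<lambda>x. emeasure (P x) A) \<in> borel_measurable \<pi>"
      by (rule measurable_emeasure_kernel[OF kernel_subprob A])
    have "emeasure (N \<bind> P) A = (\<integral>\<^sup>+x. emeasure (P x) A \<partial>N)"
      by (rule emeasure_bind[OF N K A])
    also have "\<dots> = (\<integral>\<^sup>+x. ennreal (h x) * emeasure (P x) A \<partial>\<pi>)"
      unfolding N_def by (rule nn_integral_density) measurable
    also have "\<dots> \<le> (\<integral>\<^sup>+x. ennreal C * emeasure (P x) A \<partial>\<pi>)"
      using C h0 by (intro nn_integral_mono mult_right_mono ennreal_leI) fastforce+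
    also have "\<dots> = C * emeasure (\<pi> \<bind> P) A"
      by (simp add: nn_integral_cmult emeasure_bind[OF not_empty kernel_subprob A])
    finally show ?thesis by (simp add: invariant)
  qed
  obtain k where k[measurable]: "k \<in> borel_measurable \<pi>" and k0: "\<And>x. 0 \<le> k x" and kC: "\<And>x. k x \<le> C"
    and dk: "density \<pi> k = N \<bind> P"
    using RN_deriv_bounded[OF sets C(1) le] by metis
  have kb: "bounded_fun k" using k0 kC by (intro bounded_funI[OF k, of C]) auto
  show ?thesis
  proof (rule that[OF kb])
    fix g :: "'a \<Rightarrow> real" assume g: "integrable \<pi> g"
    then have [measurable]: "g \<in> borel_measurable \<pi>" by auto
    have gi: "integrable (N \<bind> P) g"
      unfolding dk[symmetric] using integrable_mult_bounded_fun[OF g kb] k0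
      by (subst integrable_density) (auto simp: mult.commute)
    have "l2_inner \<pi> (markov_op P g) h = (\<integral>x. h x *\<^sub>R markov_op P g x \<partial>\<pi>)"
      by (simp add: l2_inner_def mult.commute)
    also have "\<dots> = (\<integral>x. markov_op P g x \<partial>N)"
      unfolding N_def using h0 by (subst integral_density) auto
    also have "\<dots> = (\<integral>x. g x \<partial>(N \<bind> P))"
      unfolding markov_op_def by (rule integral_bind_integrable[OF K gi N])
    also have "\<dots> = l2_inner \<pi> g k"
      unfolding dk[symmetric] using k0 by (subst integral_density) (auto simp: l2_inner_def mult.commute)
    finally show "l2_inner \<pi> (markov_op P g) h = l2_inner \<pi> g k" .
  qed
qed

text \<open>Adding \<open>C\<close> makes \<open>h\<close> nonnegative. The adjoint fixes constants
  because \<open>P\<close> preserves means, so \<open>C\<close> can be subtracted again from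
  \<open>k\<close>.\<close>

lemma adjoint_exists:
  assumes h: "bounded_fun h"
  shows "\<exists>k\<in>l2_space \<pi>. \<forall>g\<in>l2_space \<pi>. l2_inner \<pi> (markov_op P g) h = l2_inner \<pi> g k"
proof -
  obtain C where C: "0 \<le> C" "\<And>x. x \<in> space \<pi> \<Longrightarrow> \<bar>h x\<bar> \<le> C"
    using h by (metis bounded_funE)
  have hC: "bounded_fun (\<lambda>x. h x + C)" by (intro bounded_fun_intros h)
  obtain k where k: "bounded_fun k"
    and adj: "\<And>g. integrable \<pi> g \<Longrightarrow> l2_inner \<pi> (markov_op P g) (\<lambda>x. h x + C) = l2_inner \<pi> g k"
    using adjoint_exists_nonneg[OF hC] C(2) by (metis abs_le_D2 add.commute diff_ge_0_iff_ge diff_minus_eq_add)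
  have "l2_inner \<pi> (markov_op P g) h = l2_inner \<pi> g (\<lambda>x. k x - C)" if "g \<in> l2_space \<pi>" for g
  proof -
    have g: "integrable \<pi> g" by (rule l2_space_integrable[OF that])
    have "l2_inner \<pi> (markov_op P g) (\<lambda>x. h x + C)
        = l2_inner \<pi> (markov_op P g) h + C * (\<integral>x. markov_op P g x \<partial>\<pi>)"
      using integrable_mult_bounded_fun[OF integrable_markov_op[OF g] h] integrable_markov_op[OF g]
      by (simp add: l2_inner_def ring_distribs mult.commute)
    moreover have "l2_inner \<pi> g (\<lambda>x. k x - C) = l2_inner \<pi> g k - C * (\<integral>x. g x \<partial>\<pi>)"
      using integrable_mult_bounded_fun[OF g k] g
      by (simp add: l2_inner_def right_diff_distrib mult.commute)
    ultimately show ?thesis using adj[OF g] by (simp add: integral_markov_op[OF g])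
  qed
  moreover have "(\<lambda>x. k x - C) \<in> l2_space \<pi>"
    by (intro bounded_fun_l2_space bounded_fun_intros k)
  ultimately show ?thesis by blast
qed

text \<open>\<open>l2_adjoint\<close> is a choice, which has its defining property once existence is
  known. That property at \<open>g = h\<close> shows that \<open>P\<close> and its adjoint have the
  same quadratic form.\<close>

lemma l2_inner_additive_reversiblization:
  assumes h: "bounded_fun h"
  shows "l2_inner \<pi> (additive_reversiblization \<pi> P h) h = l2_inner \<pi> (markov_op P h) h"
proof -
  define k where "k = l2_adjoint \<pi> (markov_op P) h"
  have "k \<in> l2_space \<pi> \<and> (\<forall>g\<in>l2_space \<pi>. l2_inner \<pi> (markov_op P g) h = l2_inner \<pi> g k)"
    unfolding k_def l2_adjoint_def by (rule someI_ex[OF adjoint_exists[OF h, unfolded Bex_def]])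
  then have k: "integrable \<pi> k" "l2_inner \<pi> (markov_op P h) h = l2_inner \<pi> h k"
    using bounded_fun_l2_space[OF h] by (auto intro: l2_space_integrable)
  have "l2_inner \<pi> (additive_reversiblization \<pi> P h) h
      = (\<integral>x. (markov_op P h x * h x + k x * h x) / 2 \<partial>\<pi>)"
    by (simp add: l2_inner_def additive_reversiblization_def k_def ring_distribs)
  also have "\<dots> = (l2_inner \<pi> (markov_op P h) h + l2_inner \<pi> h k) / 2"
    using integrable_mult_bounded_fun[OF k(1) h]
      integrable_bounded_fun[OF bounded_fun_mult[OF bounded_fun_markov_op[OF h] h]]
    by (simp add: l2_inner_def mult.commute)
  finally show ?thesis using k(2) by simp
qed

text \<open>Scaling to norm one brings \<open>h\<close> under the supremum, and both sides scale by
  \<open>c^2\<close>. A function of norm zero cannot be scaled, but vanishes almost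
  everywhere.\<close>

lemma l2_inner_markov_op_le_mean_zero:
  assumes h: "bounded_fun h" and h0: "expectation h = 0" and l: "lambda_r \<pi> P \<le> ereal l"
  shows "l2_inner \<pi> (markov_op P h) h \<le> l * expectation (\<lambda>x. (h x)\<^sup>2)"
proof (cases "expectation (\<lambda>x. (h x)\<^sup>2) = 0")
  case True
  then have "AE x in \<pi>. (h x)\<^sup>2 = 0"
    using integral_nonneg_eq_0_iff_AE[of \<pi> "\<lambda>x. (h x)\<^sup>2"] integrable_bounded_fun[OF bounded_fun_power2[OF h]] by auto
  then have "l2_inner \<pi> (markov_op P h) h = 0"
    unfolding l2_inner_def by (intro integral_eq_zero_AE) auto
  with True show ?thesis by simp
next
  case False
  define c where "c = 1 / sqrt (expectation (\<lambda>x. (h x)\<^sup>2))"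
  have "0 \<le> expectation (\<lambda>x. (h x)\<^sup>2)" by (rule Bochner_Integration.integral_nonneg) auto
  with False have pos: "0 < expectation (\<lambda>x. (h x)\<^sup>2)" by linarith
  then have c2: "c\<^sup>2 * expectation (\<lambda>x. (h x)\<^sup>2) = 1" by (simp add: c_def power_divide)
  let ?h = "\<lambda>x. c * h x"
  have b: "bounded_fun ?h" by (intro bounded_fun_intros h)
  have "l2_norm \<pi> ?h = 1"
    using c2 by (simp add: l2_norm_def l2_inner_def power2_eq_square algebra_simps)
  moreover have "expectation ?h = 0" using h0 by simp
  ultimately have "ereal (l2_inner \<pi> (additive_reversiblization \<pi> P ?h) ?h) \<le> lambda_r \<pi> P"
    unfolding lambda_r_def using bounded_fun_l2_space[OF b] by (intro Sup_upper) blast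
  then have "l2_inner \<pi> (markov_op P ?h) ?h \<le> l"
    using l unfolding l2_inner_additive_reversiblization[OF b] by (metis ereal_less_eq(3) order_trans)
  moreover have "l2_inner \<pi> (markov_op P ?h) ?h = c\<^sup>2 * l2_inner \<pi> (markov_op P h) h"
    by (simp add: l2_inner_def markov_op_def power2_eq_square mult.left_commute mult.assoc)
  ultimately have "c\<^sup>2 * l2_inner \<pi> (markov_op P h) h \<le> c\<^sup>2 * (l * expectation (\<lambda>x. (h x)\<^sup>2))"
    using c2 by (simp add: algebra_simps)
  moreover have "c\<^sup>2 > 0" using pos by (simp add: c_def)
  ultimately show ?thesis by (simp add: mult_le_cancel_left_pos)
qed

text \<open>Split \<open>g = h + m\<close> with \<open>h\<close> of mean zero. \<open>P\<close>
  fixes constants and preserves means, so the cross terms integrate to zero and leave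
  \<open>m^2\<close> and the form at \<open>h\<close>.\<close>

lemma l2_inner_markov_op_le:
  assumes g: "bounded_fun g" and l: "lambda_r \<pi> P \<le> ereal l"
  shows "l2_inner \<pi> (markov_op P g) g
    \<le> l * expectation (\<lambda>x. (g x)\<^sup>2) + (1 - l) * (expectation g)\<^sup>2"
proof -
  define m where "m = expectation g"
  define h where "h = (\<lambda>x. g x - m)"
  have h: "bounded_fun h" unfolding h_def by (intro bounded_fun_intros g)
  have gi: "integrable \<pi> g" by (rule integrable_bounded_fun[OF g])
  have hi: "integrable \<pi> h" by (rule integrable_bounded_fun[OF h])
  have h0: "expectation h = 0" using gi by (simp add: h_def m_def prob_space)
  have Ph: "markov_op P h x = markov_op P g x - m" if "x \<in> space \<pi>" for x
  proof -
    interpret K: prob_space "P x" by (rule prob_space_kernel[OF that])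
    show ?thesis
      using integrable_kernel_bounded_fun[OF g that] by (simp add: markov_op_def h_def K.prob_space)
  qed
  have "l2_inner \<pi> (markov_op P g) g
      = (\<integral>x. markov_op P h x * h x + m * markov_op P h x + m * h x + m\<^sup>2 \<partial>\<pi>)"
    unfolding l2_inner_def
  proof (intro Bochner_Integration.integral_cong refl)
    fix x assume "x \<in> space \<pi>"
    then have "markov_op P g x = markov_op P h x + m" "g x = h x + m"
      using Ph by (simp_all add: h_def)
    then show "markov_op P g x * g x = markov_op P h x * h x + m * markov_op P h x + m * h x + m\<^sup>2"
      by (simp only:) (simp add: algebra_simps power2_eq_square)
  qed
  also have "\<dots> = l2_inner \<pi> (markov_op P h) h + m\<^sup>2"
    using integrable_bounded_fun[OF bounded_fun_mult[OF bounded_fun_markov_op[OF h] h]] hi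
      integrable_markov_op[OF hi] h0 by (simp add: l2_inner_def integral_markov_op prob_space)
  also have "\<dots> \<le> l * expectation (\<lambda>x. (h x)\<^sup>2) + m\<^sup>2"
    using l2_inner_markov_op_le_mean_zero[OF h h0 l] by simp
  also have "expectation (\<lambda>x. (h x)\<^sup>2) = expectation (\<lambda>x. (g x)\<^sup>2) - m\<^sup>2"
    using variance_eq[OF gi] integrable_bounded_fun[OF bounded_fun_power2[OF g]]
    by (simp add: h_def m_def)
  finally show ?thesis by (simp add: m_def algebra_simps)
qed

text \<open>Pointwise Cauchy-Schwarz over the index extends a bound on the quadratic form of the positive
  operator to its tensor product with any permutation.\<close>

lemma sum_l2_inner_markov_op_le:
  fixes g :: "'i \<Rightarrow> 'a \<Rightarrow> real" and \<sigma> :: "'i \<Rightarrow> 'i"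
  assumes I: "finite I" and \<sigma>: "bij_betw \<sigma> I I" and g: "\<And>i. i \<in> I \<Longrightarrow> bounded_fun (g i)"
    and U: "bounded_fun U"
    and Q: "\<And>h. bounded_fun h \<Longrightarrow> l2_inner \<pi> (markov_op P h) h \<le> expectation (\<lambda>x. (h x)\<^sup>2 * U x)"
  shows "(\<Sum>i\<in>I. l2_inner \<pi> (markov_op P (g i)) (g (\<sigma> i))) \<le> (\<Sum>i\<in>I. expectation (\<lambda>x. (g i x)\<^sup>2 * U x))"
proof -
  define G where "G = (\<lambda>x. sqrt (\<Sum>i\<in>I. (g i x)\<^sup>2))"
  have G: "bounded_fun G" unfolding G_def by (intro bounded_fun_intros g)
  have G2: "(G x)\<^sup>2 = (\<Sum>i\<in>I. (g i x)\<^sup>2)" for x by (simp add: G_def sum_nonneg)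
  have \<sigma>I: "\<sigma> i \<in> I" if "i \<in> I" for i using \<sigma> that by (auto simp: bij_betw_def)
  have "(\<Sum>i\<in>I. l2_inner \<pi> (markov_op P (g i)) (g (\<sigma> i)))
      = (\<integral>x. (\<Sum>i\<in>I. markov_op P (g i) x * g (\<sigma> i) x) \<partial>\<pi>)"
    unfolding l2_inner_def
    by (intro Bochner_Integration.integral_sum[symmetric] integrable_bounded_fun bounded_fun_intros g \<sigma>I)
  also have "\<dots> \<le> (\<integral>x. markov_op P G x * G x \<partial>\<pi>)"
  proof (rule integral_mono)
    fix x assume x: "x \<in> space \<pi>"
    have i: "integrable (P x) (\<lambda>y. g i y * g (\<sigma> i) x)" if "i \<in> I" for i
      using integrable_kernel_bounded_fun[OF g[OF that] x] by simp
    have "(\<Sum>i\<in>I. markov_op P (g i) x * g (\<sigma> i) x) = (\<integral>y. (\<Sum>i\<in>I. g i y * g (\<sigma> i) x) \<partial>P x)"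
      unfolding markov_op_def using i by simp
    \<comment> \<open>Positivity of \<open>P\<close>: a bound pointwise in \<open>y\<close> survives
      integration against \<open>P x\<close>. The permutation only reorders the squares, so the
      second factor is again \<open>G x\<close>.\<close>
    also have "\<dots> \<le> (\<integral>y. G y * G x \<partial>P x)"
    proof (rule integral_mono)
      fix y
      have s: "(\<Sum>i\<in>I. (g (\<sigma> i) x)\<^sup>2) = (\<Sum>i\<in>I. (g i x)\<^sup>2)"
        using sum.reindex_bij_betw[OF \<sigma>, of "\<lambda>i. (g i x)\<^sup>2"] .
      have "(\<Sum>i\<in>I. g i y * g (\<sigma> i) x) \<le> \<bar>\<Sum>i\<in>I. g i y * g (\<sigma> i) x\<bar>" by simp
      also have "\<dots> = sqrt ((\<Sum>i\<in>I. g i y * g (\<sigma> i) x)\<^sup>2)" by simp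
      also have "\<dots> \<le> sqrt ((\<Sum>i\<in>I. (g i y)\<^sup>2) * (\<Sum>i\<in>I. (g (\<sigma> i) x)\<^sup>2))"
        by (intro real_sqrt_le_mono Cauchy_Schwarz_ineq_sum)
      also have "\<dots> = G y * G x" by (simp add: s G_def real_sqrt_mult)
      finally show "(\<Sum>i\<in>I. g i y * g (\<sigma> i) x) \<le> G y * G x" .
    qed (use i integrable_kernel_bounded_fun[OF G x] in auto)
    also have "\<dots> = markov_op P G x * G x" by (simp add: markov_op_def)
    finally show "(\<Sum>i\<in>I. markov_op P (g i) x * g (\<sigma> i) x) \<le> markov_op P G x * G x" .
  qed (intro integrable_bounded_fun bounded_fun_intros g G \<sigma>I; assumption)+
  \<comment> \<open>The form bound is applied to the single function \<open>G\<close>, whose square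
    then splits back into the sum.\<close>
  also have "\<dots> \<le> expectation (\<lambda>x. (G x)\<^sup>2 * U x)"
    using Q[OF G] by (simp add: l2_inner_def)
  also have "\<dots> = (\<Sum>i\<in>I. expectation (\<lambda>x. (g i x)\<^sup>2 * U x))"
    unfolding G2 sum_distrib_right
    by (intro Bochner_Integration.integral_sum integrable_bounded_fun bounded_fun_intros g U)
  finally show ?thesis .
qed

section \<open>Tilted iterates and the power inequality\<close>

text \<open>For bounded \<open>w\<close>, \<open>tilt w k x\<close> is the expected product of
  \<open>w\<close> over the first \<open>k + 1\<close> states of the chain started at
  \<open>x\<close>.\<close>

fun tilt :: "('a \<Rightarrow> real) \<Rightarrow> nat \<Rightarrow> 'a \<Rightarrow> real" where
  "tilt w 0 = w"
| "tilt w (Suc k) = (\<lambda>x. w x * markov_op P (tilt w k) x)"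

lemma bounded_fun_tilt: "bounded_fun w \<Longrightarrow> bounded_fun (tilt w k)"
  by (induction k) (auto intro!: bounded_fun_intros)

text \<open>This is Berger's power inequality for the numerical radius of the symmetrised operator
  \<open>w\<^sup>1\<^sup>/\<^sup>2 P w\<^sup>1\<^sup>/\<^sup>2\<close>: along the cycle formed by the rescaled iterates all but one of the
  terms cancel.\<close>

lemma expectation_tilt_le:
  assumes w: "bounded_fun w" "bounded_fun (\<lambda>x. 1 / w x)" and w0: "\<And>x. 0 < w x" and th: "th > 0"
    and Q: "\<And>h. bounded_fun h \<Longrightarrow> l2_inner \<pi> (markov_op P h) h \<le> th * expectation (\<lambda>x. (h x)\<^sup>2 / w x)"
  shows "expectation (tilt w m) \<le> th ^ m * expectation w"
proof (cases m)
  case (Suc m')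
  \<comment> \<open>The scaling gives \<open>w x * markov_op P (g k) x = th * g (Suc k) x\<close>;
    \<open>\<sigma>\<close> is the cyclic shift of \<open>{..m'}\<close>.\<close>
  define g where "g = (\<lambda>k x. tilt w k x / th ^ k)"
  define \<sigma> where "\<sigma> = (\<lambda>k. if k = m' then 0 else Suc k)"
  define q where "q = (\<lambda>k. expectation (\<lambda>x. (g k x)\<^sup>2 * (th * (1 / w x))))"
  have g: "bounded_fun (g k)" for k
    unfolding g_def by (intro bounded_fun_intros bounded_fun_tilt w)
  have "bij_betw \<sigma> {..m'} {..m'}"
    by (rule bij_betw_byWitness[where f' = "\<lambda>k. if k = 0 then m' else k - 1"]) (auto simp: \<sigma>_def)
  moreover have "l2_inner \<pi> (markov_op P h) h \<le> expectation (\<lambda>x. (h x)\<^sup>2 * (th * (1 / w x)))"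
    if "bounded_fun h" for h
  proof -
    have "expectation (\<lambda>x. (h x)\<^sup>2 * (th * (1 / w x))) = expectation (\<lambda>x. th * ((h x)\<^sup>2 / w x))"
      by (simp add: mult.commute)
    then show ?thesis using Q[OF that] by (simp del: times_divide_eq_right)
  qed
  ultimately have "(\<Sum>k\<le>m'. l2_inner \<pi> (markov_op P (g k)) (g (\<sigma> k))) \<le> (\<Sum>k\<le>m'. q k)"
    unfolding q_def by (intro sum_l2_inner_markov_op_le bounded_fun_intros w g) auto
  \<comment> \<open>Each term with \<open>k < m'\<close> equals \<open>q (Suc k)\<close> and cancels
    against the right side. The term closing the cycle, where \<open>g 0 = w\<close>, is the wanted
    expectation, and \<open>q 0\<close> is all that remains to bound it.\<close>
  moreover have "(\<Sum>k\<le>m'. l2_inner \<pi> (markov_op P (g k)) (g (\<sigma> k)))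
      = (\<Sum>k<m'. q (Suc k)) + expectation (tilt w m) / th ^ m'"
  proof -
    have Pg: "markov_op P (g k) x = markov_op P (tilt w k) x / th ^ k" for k x
      by (simp add: markov_op_def g_def)
    have "l2_inner \<pi> (markov_op P (g k)) (g (\<sigma> k)) = q (Suc k)" if "k < m'" for k
    proof -
      have "markov_op P (g k) x * g (Suc k) x = (g (Suc k) x)\<^sup>2 * (th * (1 / w x))" for x
        unfolding Pg using th w0[of x] by (simp add: g_def power2_eq_square field_simps)
      then show ?thesis using that by (simp add: l2_inner_def q_def \<sigma>_def)
    qed
    moreover have "l2_inner \<pi> (markov_op P (g m')) (g (\<sigma> m')) = expectation (tilt w m) / th ^ m'"
      unfolding l2_inner_def Pg by (simp add: Suc \<sigma>_def g_def mult.commute)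
    ultimately show ?thesis by (simp add: lessThan_Suc_atMost[symmetric])
  qed
  moreover have "(\<Sum>k\<le>m'. q k) = q 0 + (\<Sum>k<m'. q (Suc k))"
    by (simp add: sum.atMost_shift)
  moreover have "q 0 = th * expectation w"
  proof -
    have "(g 0 x)\<^sup>2 * (th * (1 / w x)) = th * w x" for x
      using w0[of x] by (simp add: g_def power2_eq_square)
    then show ?thesis by (simp add: q_def)
  qed
  ultimately have "expectation (tilt w m) / th ^ m' \<le> th * expectation w" by simp
  then show ?thesis using th by (simp add: Suc pos_divide_le_eq mult_ac)
qed simp

subsection \<open>Markov chains\<close>

text \<open>Taking the nonnegative \<open>Z\<close> as a density turns the Markov property into an
  equality of measures: under \<open>N\<close> the law of \<open>X (Suc i)\<close> is
  \<open>N \<bind> K\<close>. It is checked on sets, and integrating \<open>h\<close> against both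
  sides replaces an approximation by simple functions.\<close>

lemma markov_chain_step:
  fixes Z :: "'w \<Rightarrow> real"
  assumes mc: "markov_chain \<Omega> \<pi> P X" and i: "1 \<le> i"
    and Z: "Z \<in> borel_measurable (past \<Omega> \<pi> X i)" "\<And>\<omega>. 0 \<le> Z \<omega>" "\<And>\<omega>. \<omega> \<in> space \<Omega> \<Longrightarrow> Z \<omega> \<le> C"
    and h: "bounded_fun h"
  shows "(\<integral>\<omega>. Z \<omega> * h (X (Suc i) \<omega>) \<partial>\<Omega>) = (\<integral>\<omega>. Z \<omega> * markov_op P h (X i \<omega>) \<partial>\<Omega>)"
proof -
  interpret O: prob_space \<Omega> using mc by (simp add: markov_chain_def)
  have X: "X j \<in> \<Omega> \<rightarrow>\<^sub>M \<pi>" if "1 \<le> j" for j using mc that by (simp add: markov_chain_def)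
  have Xi[measurable]: "X i \<in> \<Omega> \<rightarrow>\<^sub>M \<pi>" "X (Suc i) \<in> \<Omega> \<rightarrow>\<^sub>M \<pi>" using X i by auto
  have [measurable]: "h \<in> borel_measurable \<pi>" using h by measurable
  have "{X j -` A \<inter> space \<Omega> |j A. 1 \<le> j \<and> j \<le> i \<and> A \<in> sets \<pi>} \<subseteq> sets \<Omega>"
    using X by (auto intro: measurable_sets)
  then have sub: "subalgebra \<Omega> (past \<Omega> \<pi> X i)"
    by (auto simp: subalgebra_def past_def space_measure_of_conv sets_measure_of_conv
        dest: sets.sigma_sets_subset sets.sets_into_space)
  interpret S: finite_measure_subalgebra \<Omega> "past \<Omega> \<pi> X i"
    by standard (rule sub)
  have Zm[measurable]: "Z \<in> borel_measurable \<Omega>" by (rule measurable_from_subalg[OF sub Z(1)])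
  define N where "N = density \<Omega> (\<lambda>\<omega>. ennreal (Z \<omega>))"
  define K where "K = (\<lambda>\<omega>. P (X i \<omega>))"
  have N: "space N \<noteq> {}" using O.not_empty by (simp add: N_def)
  have KO[measurable]: "K \<in> \<Omega> \<rightarrow>\<^sub>M subprob_algebra \<pi>" unfolding K_def by measurable
  then have K: "K \<in> N \<rightarrow>\<^sub>M subprob_algebra \<pi>" by (simp add: N_def measurable_density_eq1)
  have XN: "X (Suc i) \<in> N \<rightarrow>\<^sub>M \<pi>" using Xi by (simp add: N_def measurable_density_eq1)
  have setsK: "sets (N \<bind> K) = sets \<pi>" by (rule sets_bind_measurable[OF K N])
  have int: "integrable \<Omega> (\<lambda>\<omega>. Z \<omega> * g \<omega>)"
    if [measurable]: "g \<in> borel_measurable \<Omega>" and g: "\<And>\<omega>. \<omega> \<in> space \<Omega> \<Longrightarrow> \<bar>g \<omega>\<bar> \<le> D" for g D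
  proof (rule O.integrable_const_bound[where B = "C * D"])
    show "AE \<omega> in \<Omega>. norm (Z \<omega> * g \<omega>) \<le> C * D"
    proof (rule AE_I2)
      fix \<omega> assume w: "\<omega> \<in> space \<Omega>"
      have "0 \<le> C" using Z(2)[of \<omega>] Z(3)[OF w] by linarith
      then show "norm (Z \<omega> * g \<omega>) \<le> C * D"
        using Z(2)[of \<omega>] Z(3)[OF w] g[OF w] by (auto simp: abs_mult intro!: mult_mono)
    qed
  qed measurable
  have eq: "N \<bind> K = distr N \<pi> (X (Suc i))"
  proof (rule measure_eqI)
    fix A assume "A \<in> sets (N \<bind> K)"
    then have A[measurable]: "A \<in> sets \<pi>" by (simp add: setsK)
    define A' where "A' = X (Suc i) -` A \<inter> space \<Omega>"
    have A'[measurable]: "A' \<in> sets \<Omega>" unfolding A'_def by measurable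
    have [measurable]: "(\<lambda>\<omega>. measure (K \<omega>) A) \<in> borel_measurable \<Omega>"
      by (rule measurable_compose[OF KO measurable_measure_subprob_algebra[OF A]])
    have KA: "emeasure (K \<omega>) A = ennreal (measure (K \<omega>) A)" "measure (K \<omega>) A \<le> 1"
      if "\<omega> \<in> space \<Omega>" for \<omega>
    proof -
      interpret k: prob_space "K \<omega>"
        unfolding K_def by (rule prob_space_kernel[OF measurable_space[OF Xi(1) that]])
      show "emeasure (K \<omega>) A = ennreal (measure (K \<omega>) A)" "measure (K \<omega>) A \<le> 1"
        by (rule k.emeasure_eq_measure, rule k.prob_le_1)
    qed
    have int1: "integrable \<Omega> (\<lambda>\<omega>. Z \<omega> * indicator A' \<omega>)" by (rule int[of _ 1]) auto
    have int2: "integrable \<Omega> (\<lambda>\<omega>. Z \<omega> * measure (K \<omega>) A)"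
      by (rule int[of _ 1]) (auto simp: KA)
    have ce: "AE \<omega> in \<Omega>. real_cond_exp \<Omega> (past \<Omega> \<pi> X i) (indicator A') \<omega> = measure (K \<omega>) A"
      using mc i A by (simp add: markov_chain_def A'_def K_def)
    have "emeasure (N \<bind> K) A = (\<integral>\<^sup>+\<omega>. emeasure (K \<omega>) A \<partial>N)" by (rule emeasure_bind[OF N K A])
    also have "\<dots> = (\<integral>\<^sup>+\<omega>. ennreal (Z \<omega>) * emeasure (K \<omega>) A \<partial>\<Omega>)"
      unfolding N_def by (rule nn_integral_density) measurable
    also have "\<dots> = (\<integral>\<^sup>+\<omega>. ennreal (Z \<omega> * measure (K \<omega>) A) \<partial>\<Omega>)"
      using Z(2) by (intro nn_integral_cong) (simp add: KA ennreal_mult)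
    also have "\<dots> = ennreal (\<integral>\<omega>. Z \<omega> * measure (K \<omega>) A \<partial>\<Omega>)"
      using int2 Z(2) by (intro nn_integral_eq_integral) auto
    also have "(\<integral>\<omega>. Z \<omega> * measure (K \<omega>) A \<partial>\<Omega>)
        = (\<integral>\<omega>. Z \<omega> * real_cond_exp \<Omega> (past \<Omega> \<pi> X i) (indicator A') \<omega> \<partial>\<Omega>)"
      using ce by (intro integral_cong_AE) auto
    \<comment> \<open>The defining property of the conditional expectation, applicable because
      \<open>Z\<close> is measurable with respect to the past.\<close>
    also have "\<dots> = (\<integral>\<omega>. Z \<omega> * indicator A' \<omega> \<partial>\<Omega>)"
      by (rule S.real_cond_exp_intg(2)[OF int1 Z(1)]) measurable
    also have "ennreal \<dots> = (\<integral>\<^sup>+\<omega>. ennreal (Z \<omega> * indicator A' \<omega>) \<partial>\<Omega>)"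
      using int1 Z(2) by (intro nn_integral_eq_integral[symmetric]) auto
    also have "\<dots> = (\<integral>\<^sup>+\<omega>. ennreal (Z \<omega>) * indicator A' \<omega> \<partial>\<Omega>)"
      by (intro nn_integral_cong) (auto simp: indicator_def)
    also have "\<dots> = emeasure N A'" unfolding N_def by (subst emeasure_density) auto
    also have "\<dots> = emeasure (distr N \<pi> (X (Suc i))) A"
      unfolding emeasure_distr[OF XN A] A'_def by (simp add: N_def)
    finally show "emeasure (N \<bind> K) A = emeasure (distr N \<pi> (X (Suc i))) A" .
  qed (simp add: setsK)
  obtain D where D: "0 \<le> D" "\<And>x. x \<in> space \<pi> \<Longrightarrow> \<bar>h x\<bar> \<le> D" using h by (metis bounded_funE)
  have "integrable \<Omega> (\<lambda>\<omega>. Z \<omega> * h (X (Suc i) \<omega>))"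
    using measurable_space[OF Xi(2)] D by (intro int[of _ D]) auto
  then have "integrable N (\<lambda>\<omega>. h (X (Suc i) \<omega>))"
    unfolding N_def using Z(2) by (subst integrable_density) auto
  then have hi: "integrable (N \<bind> K) h" unfolding eq by (subst integrable_distr_eq[OF XN]) auto
  have [measurable]: "(\<lambda>\<omega>. markov_op P h (X i \<omega>)) \<in> borel_measurable \<Omega>"
    using borel_measurable_markov_op[of h] by measurable
  have "(\<integral>\<omega>. Z \<omega> * h (X (Suc i) \<omega>) \<partial>\<Omega>) = (\<integral>\<omega>. h (X (Suc i) \<omega>) \<partial>N)"
    unfolding N_def using Z(2) by (subst integral_density) auto
  also have "\<dots> = (\<integral>x. h x \<partial>(N \<bind> K))" unfolding eq by (subst integral_distr[OF XN]) auto
  also have "\<dots> = (\<integral>\<omega>. markov_op P h (X i \<omega>) \<partial>N)"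
    using integral_bind_integrable[OF K hi N] by (simp add: K_def markov_op_def)
  also have "\<dots> = (\<integral>\<omega>. Z \<omega> * markov_op P h (X i \<omega>) \<partial>\<Omega>)"
    unfolding N_def using Z(2) by (subst integral_density) auto
  finally show ?thesis .
qed

text \<open>The states are integrated out from the last to the first. The product runs to
  \<open>Suc i\<close> because \<open>tilt w i\<close> has \<open>i + 1\<close> factors.\<close>

lemma integral_prod_markov_chain:
  assumes mc: "markov_chain \<Omega> \<pi> P X" and X1: "distr \<Omega> \<pi> (X 1) = \<pi>"
    and w: "bounded_fun w" and w0: "\<And>x. 0 < w x"
  shows "(\<integral>\<omega>. (\<Prod>j=1..Suc i. w (X j \<omega>)) \<partial>\<Omega>) = expectation (tilt w i)"
proof -
  have X: "X j \<in> \<Omega> \<rightarrow>\<^sub>M \<pi>" if "1 \<le> j" for j using mc that by (simp add: markov_chain_def)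
  obtain C where C: "0 \<le> C" "\<And>x. x \<in> space \<pi> \<Longrightarrow> \<bar>w x\<bar> \<le> C" using w by (metis bounded_funE)
  define Z where "Z = (\<lambda>i \<omega>. \<Prod>j=1..i. w (X j \<omega>))"
  have Z0: "0 \<le> Z i \<omega>" for i \<omega> unfolding Z_def using w0 by (intro prod_nonneg) (auto intro: less_imp_le)
  have ZC: "Z i \<omega> \<le> C ^ i" if "\<omega> \<in> space \<Omega>" for i \<omega>
  proof -
    have "Z i \<omega> \<le> (\<Prod>j=1..i. C)" unfolding Z_def
    proof (intro prod_mono conjI)
      fix j assume "j \<in> {1..i}"
      then show "w (X j \<omega>) \<le> C" using C(2)[of "X j \<omega>"] measurable_space[OF X[of j] that] by auto
    qed (auto intro: less_imp_le[OF w0])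
    then show ?thesis by simp
  qed
  have Zm: "Z i \<in> borel_measurable (past \<Omega> \<pi> X i)" for i
    unfolding Z_def
  proof (rule borel_measurable_prod)
    fix j assume j: "j \<in> {1..i}"
    have "X j \<in> past \<Omega> \<pi> X i \<rightarrow>\<^sub>M \<pi>"
      unfolding past_def
    proof (rule measurableI)
      fix A assume "A \<in> sets \<pi>"
      with j show "X j -` A \<inter> space (sigma (space \<Omega>) {X j -` A \<inter> space \<Omega> |j A. 1 \<le> j \<and> j \<le> i \<and> A \<in> sets \<pi>})
          \<in> sets (sigma (space \<Omega>) {X j -` A \<inter> space \<Omega> |j A. 1 \<le> j \<and> j \<le> i \<and> A \<in> sets \<pi>})"
        by (subst sets_measure_of) (auto simp: space_measure_of_conv intro!: sigma_sets.Basic)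
    qed (use measurable_space[OF X[of j]] j in \<open>auto simp: space_measure_of_conv\<close>)
    then show "(\<lambda>\<omega>. w (X j \<omega>)) \<in> borel_measurable (past \<Omega> \<pi> X i)"
      using w by (auto intro: measurable_compose bounded_fun_measurable)
  qed
  \<comment> \<open>Generalised for the induction: \<open>k + 1\<close> factors are already folded
    into \<open>tilt w k\<close> at state \<open>Suc i\<close>, and each step folds in one more. For
    \<open>i = 0\<close> the product is empty and \<open>X 1\<close> has law
    \<open>\<pi>\<close>.\<close>
  have "(\<integral>\<omega>. Z i \<omega> * tilt w k (X (Suc i) \<omega>) \<partial>\<Omega>) = expectation (tilt w (k + i))" for k
  proof (induction i arbitrary: k)
    case 0
    have "(\<integral>\<omega>. tilt w k (X 1 \<omega>) \<partial>\<Omega>) = (\<integral>x. tilt w k x \<partial>distr \<Omega> \<pi> (X 1))"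
      using bounded_fun_measurable[OF bounded_fun_tilt[OF w]] X[of 1] by (subst integral_distr) auto
    then show ?case by (simp add: Z_def X1[simplified])
  next
    case (Suc i)
    have "(\<integral>\<omega>. Z (Suc i) \<omega> * tilt w k (X (Suc (Suc i)) \<omega>) \<partial>\<Omega>)
        = (\<integral>\<omega>. Z (Suc i) \<omega> * markov_op P (tilt w k) (X (Suc i) \<omega>) \<partial>\<Omega>)"
      by (rule markov_chain_step[OF mc _ Zm Z0 ZC bounded_fun_tilt[OF w]]) auto
    also have "\<dots> = (\<integral>\<omega>. Z i \<omega> * tilt w (Suc k) (X (Suc i) \<omega>) \<partial>\<Omega>)"
      by (simp add: Z_def mult.assoc)
    also have "\<dots> = expectation (tilt w (Suc k + i))" by (rule Suc.IH)
    finally show ?case by (simp only: add_Suc add_Suc_right)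
  qed
  from this[of 0] show ?thesis by (simp add: Z_def)
qed

section \<open>The moment generating function\<close>

lemma markov_chain_mgf_le:
  fixes f :: "'a \<Rightarrow> real"
  assumes gap: "has_right_spectral_gap \<pi> P"
    and mc: "markov_chain \<Omega> \<pi> P X" and X1: "distr \<Omega> \<pi> (X 1) = \<pi>" and n: "1 \<le> n"
    and f[measurable]: "f \<in> borel_measurable \<pi>" and fab: "\<forall>x\<in>space \<pi>. f x \<in> {a..b}" and ab: "a < b"
  shows "(\<integral>\<omega>. exp (t * ((\<Sum>i=1..n. f (X i \<omega>)) - real n * expectation f)) \<partial>\<Omega>)
    \<le> exp (t\<^sup>2 / 2 * alpha (real_of_ereal (max (lambda_r \<pi> P) 0)) * (real n * (b - a)\<^sup>2 / 4))"
\<comment> \<open>For \<open>t = 0\<close> the range of \<open>F\<close> would degenerate to a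
  point, while the two-point bounds divide by \<open>B - A\<close>.\<close>
proof (cases "t = 0")
  case True
  interpret O: prob_space \<Omega> using mc by (simp add: markov_chain_def)
  show ?thesis using True by (simp add: O.prob_space)
next
  case False
  define l where "l = real_of_ereal (max (lambda_r \<pi> P) 0)"
  \<comment> \<open>The gap excludes plus infinity and the maximum with 0 excludes minus infinity,
    so \<open>real_of_ereal\<close> loses nothing.\<close>
  have max: "max (lambda_r \<pi> P) 0 = ereal l"
    using gap unfolding l_def has_right_spectral_gap_def
    by (cases "lambda_r \<pi> P") (auto simp: max_def zero_ereal_def)
  have "0 \<le> ereal l" "lambda_r \<pi> P \<le> ereal l" unfolding max[symmetric] by simp_all
  moreover have "ereal l < 1" using gap unfolding max[symmetric] has_right_spectral_gap_def by simp
  ultimately have l: "0 \<le> l" "l < 1" "lambda_r \<pi> P \<le> ereal l" by (simp_all add: one_ereal_def)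
  define m where "m = expectation f"
  define F where "F = (\<lambda>x. t * (f x - m))"
  \<comment> \<open>A negative \<open>t\<close> exchanges the endpoints.\<close>
  define A where "A = (if 0 < t then t * (a - m) else t * (b - m))"
  define B where "B = (if 0 < t then t * (b - m) else t * (a - m))"
  define w where "w = (\<lambda>x. exp (F x))"
  have BA: "B - A = \<bar>t\<bar> * (b - a)" by (auto simp: A_def B_def algebra_simps)
  have AB: "A < B" using BA ab False by (smt (verit) mult_pos_pos)
  have [measurable]: "F \<in> borel_measurable \<pi>" by (simp add: F_def)
  have FAB: "\<forall>x\<in>space \<pi>. F x \<in> {A..B}"
    using fab by (auto simp: F_def A_def B_def mult_le_cancel_left)
  have fb: "bounded_fun f"
    using fab by (intro bounded_funI[where C = "\<bar>a\<bar> + \<bar>b\<bar>"]) fastforce+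
  have F0: "expectation F = 0"
    using integrable_bounded_fun[OF fb] by (simp add: F_def m_def prob_space)
  have w: "bounded_fun w"
    using FAB by (intro bounded_funI[where C = "exp B"]) (auto simp: w_def)
  have w': "bounded_fun (\<lambda>x. 1 / w x)"
    using FAB by (intro bounded_funI[where C = "exp (- A)"]) (auto simp: w_def simp flip: exp_minus inverse_eq_divide)
  have w0: "0 < w x" for x by (simp add: w_def)
  define th where "th = exp (alpha l * (B - A)\<^sup>2 / 8)"
  have form: "l * expectation (\<lambda>x. (g x)\<^sup>2) + (1 - l) * (expectation g)\<^sup>2 \<le> th * expectation (\<lambda>x. (g x)\<^sup>2 / w x)"
    if "bounded_fun g" for g
    unfolding th_def w_def using that l(1,2) FAB F0 AB
    by (intro gap_form_le integrable_bounded_fun bounded_fun_intros) auto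
  have "l2_inner \<pi> (markov_op P h) h \<le> th * expectation (\<lambda>x. (h x)\<^sup>2 / w x)" if "bounded_fun h" for h
    using l2_inner_markov_op_le[OF that l(3)] form[OF that] by linarith
  from expectation_tilt_le[OF w w' w0 _ this, of "n - 1"]
  have tilt: "expectation (tilt w (n - 1)) \<le> th ^ (n - 1) * expectation w" by (simp add: th_def)
  \<comment> \<open>The power inequality accounts for \<open>n - 1\<close> factors
    \<open>th\<close>; the last one comes from here. The form bound at \<open>g = w\<close>, where
    \<open>w^2 / w = w\<close>, combines with
    \<open>(expectation w)^2 \<le> expectation (w^2)\<close>.\<close>
  have "expectation w \<le> th"
  proof -
    have wi: "integrable \<pi> w" "integrable \<pi> (\<lambda>x. (w x)\<^sup>2)"
      by (intro integrable_bounded_fun bounded_fun_intros w)+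
    have "(expectation w)\<^sup>2 \<le> expectation (\<lambda>x. (w x)\<^sup>2)"
      using variance_eq[OF wi] variance_positive[of w] by linarith
    then have "l * (expectation w)\<^sup>2 + (1 - l) * (expectation w)\<^sup>2
        \<le> l * expectation (\<lambda>x. (w x)\<^sup>2) + (1 - l) * (expectation w)\<^sup>2"
      using l by (intro add_right_mono mult_left_mono)
    also have "\<dots> \<le> th * expectation (\<lambda>x. (w x)\<^sup>2 / w x)" by (rule form[OF w])
    also have "(\<lambda>x. (w x)\<^sup>2 / w x) = w" using w0 by (auto simp: power2_eq_square w_def)
    finally have "expectation w * expectation w \<le> th * expectation w"
      by (simp add: algebra_simps power2_eq_square)
    moreover have "0 \<le> expectation w" using w0 by (intro Bochner_Integration.integral_nonneg) (auto intro: less_imp_le)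
    ultimately show ?thesis by (cases "expectation w = 0") (auto simp: th_def mult_le_cancel_right)
  qed
  then have "th ^ (n - 1) * expectation w \<le> th ^ (n - 1) * th"
    by (intro mult_left_mono) (auto simp: th_def)
  also have "\<dots> = th ^ n" using n by (simp flip: power_Suc2)
  finally have "expectation (tilt w (n - 1)) \<le> th ^ n" using tilt by linarith
  moreover have "expectation (tilt w (n - 1)) = (\<integral>\<omega>. (\<Prod>j=1..n. w (X j \<omega>)) \<partial>\<Omega>)"
    using integral_prod_markov_chain[OF mc X1 w w0, of "n - 1"] n by simp
  moreover have "(\<Prod>j=1..n. w (X j \<omega>)) = exp (t * ((\<Sum>i=1..n. f (X i \<omega>)) - real n * m))" for \<omega>
    by (simp add: w_def F_def sum_subtractf flip: exp_sum sum_distrib_left)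
  moreover have "th ^ n = exp (t\<^sup>2 / 2 * alpha l * (real n * (b - a)\<^sup>2 / 4))"
    unfolding th_def BA power_mult_distrib power2_abs exp_of_nat_mult[symmetric] by (simp add: mult_ac)
  ultimately show ?thesis by (simp add: l_def m_def)
qed

end

section \<open>Chernoff bound and conclusion\<close>

lemma (in prob_space) two_sided_Chernoff:
  fixes S :: "'a \<Rightarrow> real"
  assumes S[measurable]: "random_variable borel S" and bnd: "\<And>x. x \<in> space M \<Longrightarrow> \<bar>S x\<bar> \<le> C"
    and D: "0 < D" and mgf: "\<And>t. expectation (\<lambda>x. exp (t * S x)) \<le> exp (t\<^sup>2 / 2 * D)" and e: "\<epsilon> > 0"
  shows "prob {x \<in> space M. \<epsilon> < \<bar>S x\<bar>} \<le> 2 * exp (- (\<epsilon>\<^sup>2 / (2 * D)))"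
proof -
  \<comment> \<open>The sign \<open>s\<close> treats both tails at once.\<close>
  have one: "prob {x \<in> space M. \<epsilon> < s * S x} \<le> exp (- (\<epsilon>\<^sup>2 / (2 * D)))" if s: "\<bar>s\<bar> = 1" for s
  proof -
    \<comment> \<open>The minimiser of \<open>t^2 / 2 * D - t * \<epsilon>\<close>.\<close>
    let ?t = "\<epsilon> / D"
    let ?E = "\<lambda>x. exp ((?t * s) * S x)"
    have "norm (?E x) \<le> exp (?t * C)" if "x \<in> space M" for x
    proof -
      have "s * S x \<le> C" using bnd[OF that] s by (auto simp: abs_if split: if_splits)
      then show ?thesis using e D by (simp add: mult.assoc divide_right_mono mult_left_mono)
    qed
    then have i: "integrable M ?E" by (intro integrable_const_bound[where B = "exp (?t * C)"] AE_I2) auto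
    have "prob {x \<in> space M. \<epsilon> < s * S x} \<le> prob {x \<in> space M. exp (?t * \<epsilon>) \<le> ?E x}"
    proof (rule finite_measure_mono)
      show "{x \<in> space M. \<epsilon> < s * S x} \<subseteq> {x \<in> space M. exp (?t * \<epsilon>) \<le> ?E x}"
      proof (intro Collect_mono impI conjI; elim conjE)
        fix x assume "\<epsilon> < s * S x"
        then have "?t * \<epsilon> \<le> ?t * (s * S x)" using e D by (intro mult_left_mono) auto
        then show "exp (?t * \<epsilon>) \<le> ?E x" by (simp add: mult.assoc)
      qed
    qed measurable
    also have "\<dots> \<le> expectation ?E / exp (?t * \<epsilon>)"
      using integral_Markov_inequality_measure[OF i, of "{}" "exp (?t * \<epsilon>)"] by simp
    also have "\<dots> \<le> exp ((?t * s)\<^sup>2 / 2 * D) / exp (?t * \<epsilon>)"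
      using mgf[of "?t * s"] by (intro divide_right_mono) auto
    also have "\<dots> = exp (?t\<^sup>2 / 2 * D - ?t * \<epsilon>)"
      using s by (auto simp: exp_diff power_mult_distrib abs_if split: if_splits)
    also have "?t\<^sup>2 / 2 * D - ?t * \<epsilon> = - (\<epsilon>\<^sup>2 / (2 * D))"
      using D by (simp add: field_simps power2_eq_square)
    finally show ?thesis .
  qed
  have "prob {x \<in> space M. \<epsilon> < \<bar>S x\<bar>}
      \<le> prob ({x \<in> space M. \<epsilon> < 1 * S x} \<union> {x \<in> space M. \<epsilon> < (-1) * S x})"
    by (intro finite_measure_mono) auto
  also have "\<dots> \<le> prob {x \<in> space M. \<epsilon> < 1 * S x} + prob {x \<in> space M. \<epsilon> < (-1) * S x}"
    by (rule measure_Un_le) measurable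
  also have "\<dots> \<le> exp (- (\<epsilon>\<^sup>2 / (2 * D))) + exp (- (\<epsilon>\<^sup>2 / (2 * D)))"
    by (intro add_mono one) auto
  finally show ?thesis by simp
qed

theorem theorem2p2:
  fixes M \<pi> :: "'a measure" and P :: "'a \<Rightarrow> 'a measure"
    and \<Omega> :: "'w measure" and X :: "nat \<Rightarrow> 'w \<Rightarrow> 'a"
    and f :: "'a \<Rightarrow> real" and a b :: real and n :: nat
  assumes "standard_borel M"
    and "transition_kernel M P"
    and "invariant_prob M P \<pi>"
    and "has_right_spectral_gap \<pi> P"
    and "markov_chain \<Omega> M P X"
    and "distr \<Omega> M (X 1) = \<pi>"
    and "n \<ge> 1"
    and "f \<in> borel_measurable M"
    and "\<forall>x\<in>space M. f x \<in> {a..b}"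
  shows "(\<forall>t::real.
            (\<integral>\<omega>. exp (t * ((\<Sum>i=1..n. f (X i \<omega>)) - real n * (\<integral>x. f x \<partial>\<pi>))) \<partial>\<Omega>)
              \<le> exp (t\<^sup>2 / 2 * alpha (real_of_ereal (max (lambda_r \<pi> P) 0))
                      * (real n * (b - a)\<^sup>2 / 4)))
       \<and> (\<forall>\<epsilon>::real. \<epsilon> > 0 \<longrightarrow>
            measure \<Omega> {\<omega> \<in> space \<Omega>.
                \<bar>(\<Sum>i=1..n. f (X i \<omega>)) - real n * (\<integral>x. f x \<partial>\<pi>)\<bar> > \<epsilon>}
              \<le> 2 * exp (- (inverse (alpha (real_of_ereal (max (lambda_r \<pi> P) 0))) * \<epsilon>\<^sup>2
                            / (2 * (real n * (b - a)\<^sup>2 / 4)))))"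
proof -
  have sets[measurable_cong]: "sets \<pi> = sets M" and prob: "prob_space \<pi>"
    and inv: "\<And>A. A \<in> sets M \<Longrightarrow> emeasure \<pi> A = (\<integral>\<^sup>+ x. emeasure (P x) A \<partial>\<pi>)"
    using assms(3) by (auto simp: invariant_prob_def)
  have space: "space \<pi> = space M" by (rule sets_eq_imp_space_eq[OF sets])
  interpret \<pi>: prob_space \<pi> by (rule prob)
  have kernel: "P \<in> \<pi> \<rightarrow>\<^sub>M prob_algebra \<pi>"
    using assms(2) unfolding transition_kernel_def
    by (simp add: measurable_cong_sets[OF sets refl] prob_algebra_def subprob_algebra_cong[OF sets])
  interpret invariant_kernel \<pi> P
  proof
    show "P \<in> \<pi> \<rightarrow>\<^sub>M prob_algebra \<pi>" by (rule kernel)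
    note K = measurable_prob_algebraD[OF kernel]
    show "\<pi> \<bind> P = \<pi>"
    proof (rule measure_eqI)
      show "sets (\<pi> \<bind> P) = sets \<pi>" by (rule sets_bind_measurable[OF K \<pi>.not_empty])
      then show "emeasure (\<pi> \<bind> P) A = emeasure \<pi> A" if "A \<in> sets (\<pi> \<bind> P)" for A
        using that inv[of A] by (simp add: emeasure_bind[OF \<pi>.not_empty K] sets)
    qed
  qed
  have mc: "markov_chain \<Omega> \<pi> P X"
    using assms(5) by (simp add: markov_chain_def past_def sets measurable_cong_sets[OF refl sets])
  have X1: "distr \<Omega> \<pi> (X 1) = \<pi>"
    using assms(6) by (metis distr_cong sets)
  have f[measurable]: "f \<in> borel_measurable \<pi>" and fab: "\<forall>x\<in>space \<pi>. f x \<in> {a..b}"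
    using assms(8,9) by (simp_all add: space measurable_cong_sets[OF sets refl])
  interpret O: prob_space \<Omega> using mc by (simp add: markov_chain_def)
  have X: "X i \<in> \<Omega> \<rightarrow>\<^sub>M \<pi>" if "1 \<le> i" for i using mc that by (simp add: markov_chain_def)
  define m where "m = (\<integral>x. f x \<partial>\<pi>)"
  define S where "S = (\<lambda>\<omega>. (\<Sum>i=1..n. f (X i \<omega>)) - real n * m)"
  define al where "al = alpha (real_of_ereal (max (lambda_r \<pi> P) 0))"
  define V where "V = real n * (b - a)\<^sup>2 / 4"
  obtain x where "x \<in> space \<pi>" using \<pi>.not_empty by blast
  then have "a \<le> b" using fab by fastforce
  show ?thesis
  \<comment> \<open>For \<open>a = b\<close> the centred sum vanishes and the moment is 1. The tail
    exponent then divides by zero, which yields 0 by convention, so that bound reads 2.\<close>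
  proof (cases "a = b")
    case True
    have "m = a" unfolding m_def
      using fab True by (subst Bochner_Integration.integral_cong[where g = "\<lambda>_. a"]) (auto simp: \<pi>.prob_space)
    have "f (X i \<omega>) = a" if "\<omega> \<in> space \<Omega>" "1 \<le> i" for i \<omega>
      using fab True measurable_space[OF X[OF that(2)] that(1)] by auto
    then have "S \<omega> = 0" if "\<omega> \<in> space \<Omega>" for \<omega>
      using that \<open>m = a\<close> by (simp add: S_def)
    then have "(\<integral>\<omega>. exp (t * S \<omega>) \<partial>\<Omega>) = 1" for t
      by (subst Bochner_Integration.integral_cong[where g = "\<lambda>_. 1"]) (auto simp: O.prob_space)
    moreover have "O.prob A \<le> 2" for A using O.prob_le_1[of A] by linarith
    ultimately show ?thesis using True by (simp flip: m_def add: S_def)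
  next
    case False
    with \<open>a \<le> b\<close> have ab: "a < b" by simp
    have mgf: "(\<integral>\<omega>. exp (t * S \<omega>) \<partial>\<Omega>) \<le> exp (t\<^sup>2 / 2 * (al * V))" for t
      using markov_chain_mgf_le[OF assms(4) mc X1 assms(7) f fab ab, of t]
      by (simp add: S_def al_def V_def m_def mult.assoc)
    have "S \<in> borel_measurable \<Omega>"
      unfolding S_def using measurable_compose[OF X f] by (intro borel_measurable_diff borel_measurable_sum) auto
    moreover have "\<bar>S \<omega>\<bar> \<le> real n * (\<bar>a\<bar> + \<bar>b\<bar>) + \<bar>real n * m\<bar>" if "\<omega> \<in> space \<Omega>" for \<omega>
    proof -
      have "\<bar>\<Sum>i=1..n. f (X i \<omega>)\<bar> \<le> (\<Sum>i=1..n. \<bar>a\<bar> + \<bar>b\<bar>)"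
      proof (rule order_trans[OF sum_abs sum_mono])
        fix i assume "i \<in> {1..n}"
        then have "f (X i \<omega>) \<in> {a..b}" using fab measurable_space[OF X that, of i] by auto
        then show "\<bar>f (X i \<omega>)\<bar> \<le> \<bar>a\<bar> + \<bar>b\<bar>" by auto
      qed
      then show ?thesis unfolding S_def by simp
    qed
    \<comment> \<open>The Chernoff bound divides by this variance proxy; it is positive since the
      maximum lies in \<open>[0, 1)\<close>.\<close>
    moreover have "0 < al * V"
    proof -
      have "0 \<le> max (lambda_r \<pi> P) 0" "max (lambda_r \<pi> P) 0 < 1"
        using assms(4) by (auto simp: has_right_spectral_gap_def)
      then have "0 < al" unfolding al_def alpha_def
        by (cases "max (lambda_r \<pi> P) 0") (auto simp: one_ereal_def)
      then show ?thesis using ab assms(7) by (simp add: V_def)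
    qed
    ultimately have "O.prob {\<omega> \<in> space \<Omega>. \<epsilon> < \<bar>S \<omega>\<bar>} \<le> 2 * exp (- (\<epsilon>\<^sup>2 / (2 * (al * V))))" if "\<epsilon> > 0" for \<epsilon>
      using mgf that by (rule O.two_sided_Chernoff)
    moreover have "\<epsilon>\<^sup>2 / (2 * (al * V)) = inverse al * \<epsilon>\<^sup>2 / (2 * V)" for \<epsilon>
      by (simp add: field_simps)
    ultimately show ?thesis
      using mgf by (simp add: S_def al_def V_def m_def mult.assoc)
  qed
qed

end
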